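(* Let $Z$ be a complex-analytic map from a neighborhood of $0$ in $(\mathbb{C}^d)^{N+1}$ to $\mathbb{C}^d$ with $Z(0,\ldots,0)=0$, and assume $B_0=\partial_0Z(0)$ is non-singular. Let $\boldsymbol\lambda=(\lambda_1,\ldots,\lambda_m)$ be a stable non-resonant vector of eigenvalues with corresponding eigenvectors $v_1,\ldots,v_m$ (i.e. $T(\lambda_j)v_j=0$, $v_j\neq0$), and set $\Lambda=\mathrm{diag}(\lambda_1,\ldots,\lambda_m)$, $V=(v_1\cdots v_m)$. Then there exists a function $P$, analytic on a neighborhood of $0\in\mathbb{C}^m$ with values in $\mathbb{C}^d$, such that $P(0)=0$, $P'(0)=V$, and $$Z\big(P(z),P(\Lambda z),\ldots,P(\Lambda^Nz)\big)=0$$ for all $z$ in a neighborhood of $0$. Moreover, such a $P$ is unique (as a germ of analytic functions at $0$ with $P(0)=0$, $P'(0)=V$).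
   Context: $B_i=\partial_iZ(0)$ denotes the $d\times d$ derivative of $Z$ with respect to its $i$-th block variable, $i=0,\ldots,N$; $T(\lambda)=\sum_{i=0}^N\lambda^iB_i$; $\mathcal{F}(\lambda)=\det T(\lambda)$ is the characteristic polynomial. Multi-index notation: $\boldsymbol\lambda^\alpha=\lambda_1^{\alpha_1}\cdots\lambda_m^{\alpha_m}$, $|\alpha|=\sum\alpha_i$. A vector $\boldsymbol\lambda\in\mathbb{C}^m$ is a stable non-resonant vector of eigenvalues if $|\lambda_i|<1$ and $\mathcal{F}(\lambda_i)=0$ for all $i$, and $\mathcal{F}(\boldsymbol\lambda^\alpha)\ne0$ for all $\alpha\in\mathbb{Z}_+^m$ with $|\alpha|\ge2$. *)

theory Defs
  imports "HOL-Analysis.Analysis"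
begin

definition vec_analytic_on :: "(complex^'n \<Rightarrow> complex^'k) \<Rightarrow> (complex^'n) set \<Rightarrow> bool" where
  "vec_analytic_on f S \<longleftrightarrow> open S \<and> (\<forall>a\<in>S. \<exists>r>0. \<exists>c :: ('n \<Rightarrow> nat) \<Rightarrow> complex^'k.
      \<forall>z\<in>ball a r. ((\<lambda>\<alpha>. (\<Prod>i\<in>UNIV. (z$i - a$i) ^ \<alpha> i) *s c \<alpha>) has_sum f z) UNIV)"

text \<open>Same notion for maps defined on block vectors (C^d)^(N+1), represented
  as complex^'d^'b; the variables are the entries x$k$r.\<close>

definition blk_analytic_on :: "(complex^'d^'b \<Rightarrow> complex^'k) \<Rightarrow> (complex^'d^'b) set \<Rightarrow> bool" where
  "blk_analytic_on f S \<longleftrightarrow> open S \<and> (\<forall>a\<in>S. \<exists>r>0. \<exists>c :: ('b \<Rightarrow> 'd \<Rightarrow> nat) \<Rightarrow> complex^'k.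
      \<forall>x\<in>ball a r. ((\<lambda>\<alpha>. (\<Prod>k\<in>UNIV. \<Prod>j\<in>UNIV. (x$k$j - a$k$j) ^ \<alpha> k j) *s c \<alpha>) has_sum f x) UNIV)"

definition diagpow :: "complex^'m \<Rightarrow> nat \<Rightarrow> complex^'m \<Rightarrow> complex^'m" where
  "diagpow lam k z = (\<chi> j. (lam$j) ^ k * z$j)"

definition charT :: "(nat \<Rightarrow> complex^'d^'d) \<Rightarrow> nat \<Rightarrow> complex \<Rightarrow> complex^'d^'d" where
  "charT B N \<mu> = (\<chi> r c. \<Sum>i\<le>N. \<mu> ^ i * B i $ r $ c)"

definition charF :: "(nat \<Rightarrow> complex^'d^'d) \<Rightarrow> nat \<Rightarrow> complex \<Rightarrow> complex" where
  "charF B N \<mu> = det (charT B N \<mu>)"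

definition stable_nonresonant :: "(nat \<Rightarrow> complex^'d^'d) \<Rightarrow> nat \<Rightarrow> complex^'m \<Rightarrow> bool" where
  "stable_nonresonant B N lam \<longleftrightarrow>
     (\<forall>j. norm (lam$j) < 1 \<and> charF B N (lam$j) = 0) \<and>
     (\<forall>\<alpha> :: 'm \<Rightarrow> nat. (\<Sum>j\<in>UNIV. \<alpha> j) \<ge> 2 \<longrightarrow> charF B N (\<Prod>j\<in>UNIV. (lam$j) ^ \<alpha> j) \<noteq> 0)"

text \<open>The block vector (P z, P(Lambda z), ..., P(Lambda^N z)); block k holds
  index i with ix i = k.\<close>
definition orbit_blk :: "(nat \<Rightarrow> 'b) \<Rightarrow> nat \<Rightarrow> (complex^'m \<Rightarrow> complex^'d) \<Rightarrow> complex^'m \<Rightarrow> complex^'m \<Rightarrow> complex^'d^'b" where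
  "orbit_blk ix N P lam z = (\<chi> k. P (diagpow lam (inv_into {0..N} ix k) z))"

definition solves_inv :: "(complex^'d^'b \<Rightarrow> complex^'d) \<Rightarrow> (complex^'d^'b) set \<Rightarrow> (nat \<Rightarrow> 'b) \<Rightarrow> nat
     \<Rightarrow> complex^'m \<Rightarrow> (complex^'m \<Rightarrow> complex^'d) \<Rightarrow> bool" where
  "solves_inv Z U ix N lam P \<longleftrightarrow> (\<exists>W. open W \<and> 0 \<in> W \<and>
     (\<forall>z\<in>W. orbit_blk ix N P lam z \<in> U \<and> Z (orbit_blk ix N P lam z) = 0))"

end

theory Submission
  imports Defs "HOL-Complex_Analysis.Cauchy_Integral_Formula"
begin

text \<open>Power series in \<open>m\<close> variables with absolutely summable coefficients form a commutative Banach
  algebra, in which evaluation at points of the closed unit polydisc is multiplicative and separates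
  points. After rescaling \<open>z\<close>, the unknown \<open>P\<close> is a vector over this algebra. The linear part of the
  equation acts on the coefficient of index \<open>\<alpha>\<close> as the matrix \<open>T(\<lambda>\<^sup>\<alpha>)\<close>. By non-resonance it is
  invertible for \<open>|\<alpha>| \<ge> 2\<close>, with uniformly bounded inverses because \<open>\<lambda>\<^sup>\<alpha> \<rightarrow> 0\<close> and
  \<open>T(0) = B\<^sub>0\<close> is invertible. Since the rest of \<open>Z\<close> is of order two, the equation becomes a fixed point
  problem for a contraction of a small ball, and every solution, sufficiently rescaled, lies in that
  ball.\<close>

subsection \<open>Multi-index powers and power series\<close>

no_notation Infinite_Set_Sum.abs_summable_on (infix "abs'_summable'_on" 50)

text \<open>The dilation by \<Lambda> and the inverses of T(\<lambda>^\<alpha>) both multiply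
  coefficients by bounded factors. Such operators are bounded for the l^1 norm of the coefficients,
  but in general not for a supremum norm. Degrees 0 and 1 stay outside the inversion: no hypothesis
  makes T(1) invertible, and T(\<lambda>_j) is singular. There the coefficients are prescribed, and
  the equation holds because P(0) = 0, T(\<lambda>_j) v_j = 0 and the nonlinear part starts in
  degree two. The radius \<delta> of the ball is fixed before the scale \<sigma>. A small \<sigma>
  makes the linear term \<sigma> V small, and since a solution has no constant term, P(\<sigma> w)
  has norm O(\<sigma>). How small \<sigma> must be depends on the solution, so two solutions are
  compared at a common scale, where the fixed point in the ball is unique. This is what gives
  equality of germs.\<close>

definition mdeg :: "('k::finite \<Rightarrow> nat) \<Rightarrow> nat" where
  "mdeg \<alpha> = (\<Sum>k\<in>UNIV. \<alpha> k)"

text \<open>Kept general because \<open>x\<close> will be a family of norms, of complex numbers, or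
  of elements of the power series algebra.\<close>

definition mpow :: "('k::finite \<Rightarrow> 'a::comm_monoid_mult) \<Rightarrow> ('k \<Rightarrow> nat) \<Rightarrow> 'a" where
  "mpow x \<alpha> = (\<Prod>k\<in>UNIV. x k ^ \<alpha> k)"

abbreviation unit_index :: "'k \<Rightarrow> 'k \<Rightarrow> nat" where
  "unit_index k \<equiv> (\<lambda>i. if i = k then 1 else 0)"

lemma mdeg_0_iff: "mdeg \<alpha> = 0 \<longleftrightarrow> \<alpha> = (\<lambda>_. 0)"
  by (auto simp: mdeg_def)

lemma mdeg_unit_index [simp]: "mdeg (unit_index k) = 1"
  by (simp add: mdeg_def)

lemma mdeg_zero [simp]: "mdeg (\<lambda>_. 0) = 0"
  by (simp add: mdeg_def)

lemma mdeg_ge: "\<alpha> k \<le> mdeg \<alpha>"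
  unfolding mdeg_def by (rule member_le_sum) auto

lemma mdeg_add: "mdeg (\<lambda>i. \<alpha> i + \<beta> i) = mdeg \<alpha> + mdeg \<beta>"
  by (simp add: mdeg_def sum.distrib)

lemma unit_index_split:
  assumes "\<alpha> k \<noteq> 0"
  obtains \<beta> where "\<alpha> = (\<lambda>i. unit_index k i + \<beta> i)"
proof
  show "\<alpha> = (\<lambda>i. unit_index k i + (\<alpha> i - unit_index k i))"
    using assms by auto
qed

lemma mdeg_1_iff: "mdeg \<alpha> = 1 \<longleftrightarrow> (\<exists>k. \<alpha> = unit_index k)"
proof
  assume 1: "mdeg \<alpha> = 1"
  then obtain k where k: "\<alpha> k \<noteq> 0"
    using mdeg_0_iff[of \<alpha>] by (metis ext zero_neq_one)
  obtain \<beta> where \<beta>: "\<alpha> = (\<lambda>i. unit_index k i + \<beta> i)"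
    using unit_index_split[where \<alpha>=\<alpha> and k=k] k by blast
  have "mdeg \<beta> = 0"
    using 1 unfolding \<beta> mdeg_add by simp
  then have "\<beta> = (\<lambda>_. 0)"
    by (simp add: mdeg_0_iff)
  then show "\<exists>k. \<alpha> = unit_index k"
    unfolding \<beta> by auto
qed auto

lemma mpow_add: "mpow x (\<lambda>i. \<alpha> i + \<beta> i) = mpow x \<alpha> * mpow x \<beta>"
  by (simp add: mpow_def power_add prod.distrib)

lemma mpow_mult: "mpow (\<lambda>i. x i * y i) \<alpha> = mpow x \<alpha> * mpow y \<alpha>"
  by (simp add: mpow_def power_mult_distrib prod.distrib)

lemma mpow_power: "mpow (\<lambda>i. x i ^ n) \<alpha> = (mpow x \<alpha> :: 'a::comm_semiring_1) ^ n"
  by (simp add: mpow_def prod_power_distrib mult.commute flip: power_mult)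

lemma mpow_zero_index [simp]: "mpow x (\<lambda>_. 0) = 1"
  by (simp add: mpow_def)

lemma mpow_unit_index [simp]: "mpow x (unit_index k) = x k"
proof -
  have "mpow x (unit_index k) = (\<Prod>i\<in>UNIV. if i = k then x i else 1)"
    unfolding mpow_def by (intro prod.cong) auto
  then show ?thesis by simp
qed

lemma mpow_const: "mpow (\<lambda>_. c) \<alpha> = c ^ mdeg \<alpha>"
  by (simp add: mpow_def mdeg_def power_sum)

lemma mpow_0: "mpow (\<lambda>_. 0 :: 'a::{comm_semiring_1, semiring_no_zero_divisors}) \<alpha>
    = (if \<alpha> = (\<lambda>_. 0) then 1 else 0)"
  by (auto simp: mpow_const mdeg_0_iff power_0_left)

section \<open>Norms and differences of monomials\<close>

lemma mpow_mono:
  fixes x y :: "'k::finite \<Rightarrow> real"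
  assumes "\<And>k. 0 \<le> x k" "\<And>k. x k \<le> y k"
  shows "mpow x \<alpha> \<le> mpow y \<alpha>"
  unfolding mpow_def by (intro prod_mono conjI power_mono zero_le_power assms)

lemma norm_mpow_le:
  fixes x :: "'k::finite \<Rightarrow> 'a::{real_normed_algebra_1, comm_ring_1}"
  shows "norm (mpow x \<alpha>) \<le> mpow (\<lambda>k. norm (x k)) \<alpha>"
  unfolding mpow_def
  by (rule order_trans[OF norm_prod_le], rule prod_mono) (simp add: norm_power_ineq)

lemma norm_mpow_le_power:
  fixes x :: "'k::finite \<Rightarrow> 'a::{real_normed_algebra_1, comm_ring_1}"
  assumes "\<And>k. norm (x k) \<le> s"
  shows "norm (mpow x \<alpha>) \<le> s ^ mdeg \<alpha>"
  by (rule order_trans[OF norm_mpow_le], subst mpow_const[symmetric], rule mpow_mono)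
     (use assms in auto)

text \<open>The product rule for s^n s^m, which merges the Lipschitz constants of two factors.
  Truncated subtraction is harmless: where an exponent is 0, so is the factor in front.\<close>

lemma leibniz_power_identity:
  fixes s :: real
  shows "real n * s ^ (n - 1) * s ^ m + s ^ n * (real m * s ^ (m - 1)) = real (n + m) * s ^ (n + m - 1)"
  by (cases n; cases m) (simp_all add: algebra_simps power_add)

lemma norm_power_diff_le:
  fixes x y :: "'a::{real_normed_algebra_1, comm_ring_1}"
  assumes "norm x \<le> s" "norm y \<le> s" "norm (x - y) \<le> D"
  shows "norm (x ^ n - y ^ n) \<le> real n * s ^ (n - 1) * D"
proof (induction n)
  case (Suc n)
  have s: "0 \<le> s" using assms(1) norm_ge_zero order_trans by blast
  have D: "0 \<le> D" using assms(3) norm_ge_zero order_trans by blast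
  have "x ^ Suc n - y ^ Suc n = (x - y) * x ^ n + y * (x ^ n - y ^ n)"
    by (simp add: algebra_simps)
  also have "norm \<dots> \<le> norm (x - y) * norm (x ^ n) + norm y * norm (x ^ n - y ^ n)"
    by (intro order_trans[OF norm_triangle_ineq] add_mono norm_mult_ineq)
  also have "\<dots> \<le> D * s ^ n + s * (real n * s ^ (n - 1) * D)"
    by (intro add_mono mult_mono assms Suc order_trans[OF norm_power_ineq] power_mono)
       (use s D in auto)
  also have "\<dots> = real (Suc n) * s ^ (Suc n - 1) * D"
    by (cases n) (simp_all add: algebra_simps)
  finally show ?case .
qed simp

text \<open>Factors are exchanged one variable at a time and the contributions add up as in the
  product rule. The constant therefore depends on \<alpha> only through its total degree, as for a
  single power.\<close>

lemma norm_mpow_diff_le: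
  fixes x y :: "'k::finite \<Rightarrow> 'a::{real_normed_algebra_1, comm_ring_1}"
  assumes x: "\<And>k. norm (x k) \<le> s" and y: "\<And>k. norm (y k) \<le> s"
    and D: "\<And>k. norm (x k - y k) \<le> D"
  shows "norm (mpow x \<alpha> - mpow y \<alpha>) \<le> real (mdeg \<alpha>) * s ^ (mdeg \<alpha> - 1) * D"
proof -
  have s0: "0 \<le> s" using x norm_ge_zero order_trans by blast
  have D0: "0 \<le> D" using D norm_ge_zero order_trans by blast
  have le: "norm (\<Prod>k\<in>S. x k ^ \<alpha> k) \<le> s ^ (\<Sum>k\<in>S. \<alpha> k)" for S
    unfolding power_sum
    by (rule order_trans[OF norm_prod_le], rule prod_mono)
       (use x in \<open>auto intro!: order_trans[OF norm_power_ineq] power_mono\<close>)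
  have "norm ((\<Prod>k\<in>S. x k ^ \<alpha> k) - (\<Prod>k\<in>S. y k ^ \<alpha> k))
      \<le> real (\<Sum>k\<in>S. \<alpha> k) * s ^ ((\<Sum>k\<in>S. \<alpha> k) - 1) * D" if "finite S" for S
    using that
  proof induction
    case (insert k S)
    let ?X = "\<Prod>k\<in>S. x k ^ \<alpha> k" and ?Y = "\<Prod>k\<in>S. y k ^ \<alpha> k" and ?n = "\<Sum>k\<in>S. \<alpha> k"
    have "x k ^ \<alpha> k * ?X - y k ^ \<alpha> k * ?Y = (x k ^ \<alpha> k - y k ^ \<alpha> k) * ?X + y k ^ \<alpha> k * (?X - ?Y)"
      by (simp add: algebra_simps)
    also have "norm \<dots> \<le> norm (x k ^ \<alpha> k - y k ^ \<alpha> k) * norm ?X + norm (y k ^ \<alpha> k) * norm (?X - ?Y)"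
      by (intro order_trans[OF norm_triangle_ineq] add_mono norm_mult_ineq)
    also have "\<dots> \<le> (real (\<alpha> k) * s ^ (\<alpha> k - 1) * D) * s ^ ?n + s ^ \<alpha> k * (real ?n * s ^ (?n - 1) * D)"
      by (intro add_mono mult_mono norm_power_diff_le le insert.IH x y D
          order_trans[OF norm_power_ineq] power_mono) (use s0 D0 in auto)
    also have "\<dots> = real (\<alpha> k + ?n) * s ^ (\<alpha> k + ?n - 1) * D"
      unfolding leibniz_power_identity[symmetric] by (simp add: algebra_simps)
    finally show ?case using insert.hyps by simp
  qed simp
  then show ?thesis by (simp add: mpow_def mdeg_def)
qed

section \<open>Series with weighted summable coefficients and their part of degree at least
  two\<close>

lemma mpow_series_abs_summable:
  fixes C :: "('k::finite \<Rightarrow> nat) \<Rightarrow> 'a::{real_normed_algebra_1, comm_ring_1}"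
  assumes "(\<lambda>\<alpha>. norm (C \<alpha>) * s ^ mdeg \<alpha>) summable_on A" and "\<And>k. norm (x k) \<le> s"
  shows "(\<lambda>\<alpha>. C \<alpha> * mpow x \<alpha>) abs_summable_on A"
  by (rule Infinite_Sum.abs_summable_on_comparison_test'[OF assms(1)])
     (intro order_trans[OF norm_mult_ineq] mult_left_mono norm_mpow_le_power assms norm_ge_zero)

lemma mpow_series_summable:
  fixes C :: "('k::finite \<Rightarrow> nat) \<Rightarrow> 'a::{real_normed_algebra_1, comm_ring_1, banach}"
  assumes "(\<lambda>\<alpha>. norm (C \<alpha>) * s ^ mdeg \<alpha>) summable_on UNIV" and "\<And>k. norm (x k) \<le> s"
  shows "(\<lambda>\<alpha>. C \<alpha> * mpow x \<alpha>) summable_on A"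
  by (rule abs_summable_summable, rule mpow_series_abs_summable[where s=s])
     (use assms in \<open>auto intro: summable_on_subset_banach\<close>)

definition tail_series :: "(('k::finite \<Rightarrow> nat) \<Rightarrow> 'a) \<Rightarrow> ('k \<Rightarrow> 'a::{real_normed_algebra_1, comm_ring_1}) \<Rightarrow> 'a" where
  "tail_series C x = (\<Sum>\<^sub>\<infinity>\<alpha>\<in>{\<alpha>. 2 \<le> mdeg \<alpha>}. C \<alpha> * mpow x \<alpha>)"

text \<open>Halving the radius absorbs the factor produced by differentiation, because n + 3 \<le> 2
  (n + 2). The factor t left on the right is what later makes the nonlinearity a
  contraction.\<close>

lemma mult_power_Suc_le:
  fixes s t :: real
  assumes "0 \<le> t" "2 * t \<le> s"
  shows "real (n + 2) * t ^ (n + 1) \<le> 2 * t * s ^ n"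
proof (induction n)
  case (Suc n)
  have "real (Suc n + 2) * t ^ (Suc n + 1) \<le> (2 * real (n + 2)) * t ^ (Suc n + 1)"
    using assms by (intro mult_right_mono) auto
  also have "\<dots> = (real (n + 2) * t ^ (n + 1)) * (2 * t)"
    by (simp add: algebra_simps)
  also have "\<dots> \<le> (2 * t * s ^ n) * s"
    using assms by (intro mult_mono Suc) auto
  also have "\<dots> = 2 * t * s ^ Suc n"
    by simp
  finally show ?case .
qed simp

text \<open>A monomial of degree n + 2 has Lipschitz constant (n + 2) t^(n + 1) on radius
  \<open>t\<close>, which is at most 2 t s^n. Measured against the weight s^(n + 2) this gives the
  factor \<open>2 * t / s\<^sup>2\<close>, which tends to 0 with \<open>t\<close>.\<close>

lemma tail_series_lipschitz:
  fixes C :: "('k::finite \<Rightarrow> nat) \<Rightarrow> 'a::{real_normed_algebra_1, comm_ring_1, banach}"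
  assumes C: "(\<lambda>\<alpha>. norm (C \<alpha>) * s ^ mdeg \<alpha>) summable_on UNIV" and s: "0 < s"
    and t: "2 * t \<le> s"
    and x: "\<And>k. norm (x k) \<le> t" and y: "\<And>k. norm (y k) \<le> t"
    and D: "\<And>k. norm (x k - y k) \<le> D"
  shows "norm (tail_series C x - tail_series C y)
      \<le> (\<Sum>\<^sub>\<infinity>\<alpha>. norm (C \<alpha>) * s ^ mdeg \<alpha>) * (2 * t / s\<^sup>2 * D)"
proof -
  let ?A = "{\<alpha> :: 'k \<Rightarrow> nat. 2 \<le> mdeg \<alpha>}" and ?g = "\<lambda>\<alpha>. norm (C \<alpha>) * s ^ mdeg \<alpha>"
  have t0: "0 \<le> t" using x norm_ge_zero order_trans by blast
  have D0: "0 \<le> D" using D norm_ge_zero order_trans by blast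
  have CA: "?g summable_on ?A"
    using C by (rule summable_on_subset_banach) auto
  have xs: "\<And>k. norm (x k) \<le> s" and ys: "\<And>k. norm (y k) \<le> s"
    using order_trans[OF x, of s] order_trans[OF y, of s] t t0 by auto
  have "((\<lambda>\<alpha>. C \<alpha> * mpow x \<alpha> - C \<alpha> * mpow y \<alpha>) has_sum (tail_series C x - tail_series C y)) ?A"
    unfolding tail_series_def diff_conv_add_uminus
    by (intro has_sum_add has_sum_uminusI has_sum_infsum mpow_series_summable[OF C] xs ys)
  moreover have "((\<lambda>\<alpha>. ?g \<alpha> * (2 * t / s\<^sup>2 * D)) has_sum (infsum ?g ?A * (2 * t / s\<^sup>2 * D))) ?A"
    using CA by (intro has_sum_cmult_left has_sum_infsum)
  moreover have "norm (C \<alpha> * mpow x \<alpha> - C \<alpha> * mpow y \<alpha>) \<le> ?g \<alpha> * (2 * t / s\<^sup>2 * D)" if "\<alpha> \<in> ?A" for \<alpha>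
  proof -
    define n where "n = mdeg \<alpha> - 2"
    then have n: "mdeg \<alpha> = n + 2"
      using that by simp
    have "norm (mpow x \<alpha> - mpow y \<alpha>) \<le> real (n + 2) * t ^ (n + 1) * D"
      using norm_mpow_diff_le[OF x y D, where \<alpha>=\<alpha>] unfolding n by simp
    also have "\<dots> \<le> 2 * t * s ^ n * D"
      by (rule mult_right_mono[OF mult_power_Suc_le[OF t0 t] D0])
    also have "\<dots> = s ^ mdeg \<alpha> * (2 * t / s\<^sup>2 * D)"
      using s by (simp add: n power_add power2_eq_square)
    finally have "norm (mpow x \<alpha> - mpow y \<alpha>) \<le> s ^ mdeg \<alpha> * (2 * t / s\<^sup>2 * D)" .
    then have "norm (C \<alpha>) * norm (mpow x \<alpha> - mpow y \<alpha>) \<le> norm (C \<alpha>) * (s ^ mdeg \<alpha> * (2 * t / s\<^sup>2 * D))"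
      by (rule mult_left_mono) simp
    then show ?thesis
      unfolding right_diff_distrib[symmetric] mult.assoc
      using norm_mult_ineq order_trans by blast
  qed
  ultimately have "norm (tail_series C x - tail_series C y) \<le> infsum ?g ?A * (2 * t / s\<^sup>2 * D)"
    by (rule norm_infsum_le)
  also have "\<dots> \<le> infsum ?g UNIV * (2 * t / s\<^sup>2 * D)"
    using CA C t0 D0 s
    by (intro mult_right_mono infsum_mono_neutral) (auto intro!: mult_nonneg_nonneg divide_nonneg_nonneg)
  finally show ?thesis .
qed

lemma mpow_series_has_sum:
  fixes C :: "('k::finite \<Rightarrow> nat) \<Rightarrow> 'a::{real_normed_algebra_1, comm_ring_1, banach}"
  assumes C: "(\<lambda>\<alpha>. norm (C \<alpha>) * s ^ mdeg \<alpha>) summable_on UNIV" and x: "\<And>k. norm (x k) \<le> s"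
  shows "((\<lambda>\<alpha>. C \<alpha> * mpow x \<alpha>) has_sum
      (C (\<lambda>_. 0) + (\<Sum>k\<in>UNIV. C (unit_index k) * x k) + tail_series C x)) UNIV"
proof -
  let ?f = "\<lambda>\<alpha>. C \<alpha> * mpow x \<alpha>"
  let ?U = "range (unit_index :: 'k \<Rightarrow> 'k \<Rightarrow> nat)" and ?A = "{\<alpha> :: 'k \<Rightarrow> nat. 2 \<le> mdeg \<alpha>}"
  have "inj (unit_index :: 'k \<Rightarrow> 'k \<Rightarrow> nat)"
  proof (rule injI)
    fix k l :: 'k assume "unit_index k = unit_index l"
    from fun_cong[OF this, of k] show "k = l" by (simp split: if_splits)
  qed
  then have "(?f has_sum (\<Sum>k\<in>UNIV. C (unit_index k) * x k)) ?U"
    by (intro has_sum_finiteI) (auto simp: sum.reindex)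
  moreover have "(?f has_sum C (\<lambda>_. 0)) {\<lambda>_. 0}"
    by (intro has_sum_finiteI) auto
  moreover have "(\<lambda>_. 0) \<notin> ?U"
  proof
    assume "(\<lambda>_. 0) \<in> ?U"
    then show False
    proof
      fix k assume "(\<lambda>_. 0) = unit_index k"
      from fun_cong[OF this, of k] show False by simp
    qed
  qed
  ultimately have 1: "(?f has_sum (C (\<lambda>_. 0) + (\<Sum>k\<in>UNIV. C (unit_index k) * x k))) ({\<lambda>_. 0} \<union> ?U)"
    by (intro has_sum_Un_disjoint) auto
  have "(?f has_sum tail_series C x) ?A"
    unfolding tail_series_def
    by (intro has_sum_infsum mpow_series_summable[OF C] x)
  then have "(?f has_sum (C (\<lambda>_. 0) + (\<Sum>k\<in>UNIV. C (unit_index k) * x k) + tail_series C x)) (({\<lambda>_. 0} \<union> ?U) \<union> ?A)"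
    by (intro has_sum_Un_disjoint 1) auto
  moreover have "({\<lambda>_. 0} \<union> ?U) \<union> ?A = UNIV"
  proof -
    have "\<alpha> \<in> ({\<lambda>_. 0} \<union> ?U) \<union> ?A" for \<alpha> :: "'k \<Rightarrow> nat"
    proof (cases "mdeg \<alpha> \<le> 1")
      case True
      then consider "mdeg \<alpha> = 0" | "mdeg \<alpha> = 1" by linarith
      then show ?thesis
      proof cases
        case 2
        then obtain k where "\<alpha> = unit_index k"
          unfolding mdeg_1_iff ..
        then show ?thesis by simp
      qed (simp add: mdeg_0_iff)
    qed auto
    then show ?thesis by blast
  qed
  ultimately show ?thesis by simp
qed

subsection \<open>Convolution and uniqueness of coefficients\<close>

lemma finite_below [simp]: "finite {..\<alpha> :: 'k::finite \<Rightarrow> nat}"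
proof (rule finite_subset)
  show "{..\<alpha>} \<subseteq> {f. \<forall>x. (x \<in> UNIV \<longrightarrow> f x \<in> {..mdeg \<alpha>}) \<and> (x \<notin> UNIV \<longrightarrow> f x = 0)}"
    by (auto simp: le_fun_def) (meson mdeg_ge order_trans)
  show "finite \<dots>"
    by (rule finite_set_of_finite_funs) auto
qed

text \<open>The Cauchy product. Indices are ordered pointwise, so the natural subtraction is exact
  for every \<beta> in the range of summation.\<close>

definition conv :: "(('k::finite \<Rightarrow> nat) \<Rightarrow> 'a) \<Rightarrow> (('k \<Rightarrow> nat) \<Rightarrow> 'a) \<Rightarrow> ('k \<Rightarrow> nat) \<Rightarrow> 'a::comm_semiring_0" where
  "conv f g \<alpha> = (\<Sum>\<beta>\<in>{..\<alpha>}. f \<beta> * g (\<lambda>i. \<alpha> i - \<beta> i))"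

text \<open>Absolute summability allows the double family f \<beta> g \<gamma> to be summed in two
  ways: by rows, giving the product of the sums, and along the sets \<beta> + \<gamma> = \<alpha>,
  giving \<open>conv\<close>.\<close>

lemma conv_has_sum:
  fixes f g :: "('k::finite \<Rightarrow> nat) \<Rightarrow> 'a::{real_normed_field, banach}"
  assumes f: "f abs_summable_on UNIV" and g: "g abs_summable_on UNIV"
  shows "(conv f g has_sum (infsum f UNIV * infsum g UNIV)) UNIV"
proof -
  let ?F = "\<lambda>(\<beta>, \<gamma>). f \<beta> * g \<gamma>"
  have "?F abs_summable_on UNIV \<times> UNIV"
    by (rule iffD2[OF Infinite_Sum.abs_summable_on_Sigma_iff])
       (use f g in \<open>auto simp: norm_mult infsum_cmult_right' infsum_nonneg
          intro!: summable_on_cmult_right summable_on_cmult_left\<close>)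
  then have "?F summable_on UNIV \<times> UNIV"
    by (rule abs_summable_summable)
  then obtain a where a: "(?F has_sum a) (UNIV \<times> UNIV)"
    by (auto simp: summable_on_def)
  have "((\<lambda>\<beta>. f \<beta> * infsum g UNIV) has_sum a) UNIV"
    by (rule has_sum_SigmaD[OF a]) (auto intro!: has_sum_cmult_right has_sum_infsum abs_summable_summable[OF g])
  moreover have "((\<lambda>\<beta>. f \<beta> * infsum g UNIV) has_sum (infsum f UNIV * infsum g UNIV)) UNIV"
    by (intro has_sum_cmult_left has_sum_infsum abs_summable_summable[OF f])
  ultimately have "a = infsum f UNIV * infsum g UNIV"
    by (rule has_sum_unique)
  moreover have "((\<lambda>(\<alpha>, \<beta>). f \<beta> * g (\<lambda>i. \<alpha> i - \<beta> i)) has_sum a) (Sigma UNIV (\<lambda>\<alpha>. {..\<alpha>}))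
      \<longleftrightarrow> (?F has_sum a) (UNIV \<times> UNIV)"
    by (rule has_sum_reindex_bij_witness[where j = "\<lambda>(\<alpha>, \<beta>). (\<beta>, \<lambda>i. \<alpha> i - \<beta> i)"
          and i = "\<lambda>(\<beta>, \<gamma>). (\<lambda>i. \<beta> i + \<gamma> i, \<beta>)"]) (auto simp: le_fun_def)
  ultimately have "((\<lambda>(\<alpha>, \<beta>). f \<beta> * g (\<lambda>i. \<alpha> i - \<beta> i)) has_sum (infsum f UNIV * infsum g UNIV))
      (Sigma UNIV (\<lambda>\<alpha>. {..\<alpha>}))"
    using a by simp
  then show ?thesis
    by (rule has_sum_SigmaD) (simp add: conv_def)
qed

lemma norm_conv_le:
  "norm (conv f g \<alpha>) \<le> conv (\<lambda>\<alpha>. norm (f \<alpha>)) (\<lambda>\<alpha>. norm (g \<alpha> :: 'a::real_normed_field)) \<alpha>"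
  unfolding conv_def by (rule sum_norm_le) (simp add: norm_mult)

text \<open>The Cauchy product of the real families of norms. Together with
  \<open>norm_conv_le\<close> it gives both closure under multiplication and submultiplicativity of
  the norm.\<close>

lemma conv_norm_has_sum:
  fixes f g :: "('k::finite \<Rightarrow> nat) \<Rightarrow> 'a::real_normed_field"
  assumes "f abs_summable_on UNIV" and "g abs_summable_on UNIV"
  shows "(conv (\<lambda>\<alpha>. norm (f \<alpha>)) (\<lambda>\<alpha>. norm (g \<alpha>)) has_sum
      (infsum (\<lambda>\<alpha>. norm (f \<alpha>)) UNIV * infsum (\<lambda>\<alpha>. norm (g \<alpha>)) UNIV)) UNIV"
  by (rule conv_has_sum) (use assms in auto)

lemma conv_abs_summable:
  fixes f g :: "('k::finite \<Rightarrow> nat) \<Rightarrow> 'a::real_normed_field"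
  assumes "f abs_summable_on UNIV" and "g abs_summable_on UNIV"
  shows "conv f g abs_summable_on UNIV"
  by (rule Infinite_Sum.abs_summable_on_comparison_test'[OF has_sum_imp_summable[OF conv_norm_has_sum[OF assms]]])
     (rule norm_conv_le)

lemma conv_mpow:
  "conv (\<lambda>\<alpha>. f \<alpha> * mpow z \<alpha>) (\<lambda>\<alpha>. g \<alpha> * mpow z \<alpha>) \<alpha> = conv f g \<alpha> * (mpow z \<alpha> :: 'a::comm_semiring_1)"
proof -
  have "f \<beta> * mpow z \<beta> * (g (\<lambda>i. \<alpha> i - \<beta> i) * mpow z (\<lambda>i. \<alpha> i - \<beta> i))
      = f \<beta> * g (\<lambda>i. \<alpha> i - \<beta> i) * mpow z \<alpha>" if "\<beta> \<le> \<alpha>" for \<beta>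
  proof -
    have "mpow z \<alpha> = mpow z \<beta> * mpow z (\<lambda>i. \<alpha> i - \<beta> i)"
      using that unfolding mpow_add[symmetric] by (simp add: le_fun_def)
    then show ?thesis by (simp add: mult_ac)
  qed
  then show ?thesis
    by (simp add: conv_def sum_distrib_right)
qed

section \<open>Uniqueness of coefficients, first in one variable and then in several\<close>

lemma powser_eq_0_imp_coeff_0:
  fixes a :: "nat \<Rightarrow> complex"
  assumes a: "\<And>t. norm t \<le> 1 \<Longrightarrow> (\<lambda>n. a n * t ^ n) sums 0"
  shows "a m = 0"
proof (rule ccontr)
  assume m: "a m \<noteq> 0"
  have "a 0 = 0"
    using a[of 0] by simp
  with m have "m > 0" by (cases m) auto
  \<comment> \<open>Zeros are isolated. The principle asks for a nonzero coefficient of positive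
    index, which is why \<open>a 0\<close> was settled separately at t = 0.\<close>
  obtain s where s: "0 < s" "\<And>z. z \<in> cball (0::complex) s - {0} \<Longrightarrow> (\<lambda>_. 0 :: complex) z \<noteq> 0"
    by (rule powser_0_nonzero[of 1 0 a "\<lambda>_. 0", OF _ _ _ m \<open>m > 0\<close>]) (use a in auto)
  then show False
    using s(2)[of "of_real s"] by simp
qed

lemma abs_summable_mpow:
  fixes f :: "('k::finite \<Rightarrow> nat) \<Rightarrow> 'a::real_normed_field"
  assumes f: "f abs_summable_on A" and z: "\<And>i. norm (z i) \<le> 1"
  shows "(\<lambda>\<alpha>. f \<alpha> * mpow z \<alpha>) abs_summable_on A"
proof (rule Infinite_Sum.abs_summable_on_comparison_test[OF f])
  fix \<alpha> :: "'k \<Rightarrow> nat"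
  have "norm (mpow z \<alpha>) \<le> 1"
    using norm_mpow_le_power[of z 1 \<alpha>] z by simp
  then show "norm (f \<alpha> * mpow z \<alpha>) \<le> norm (f \<alpha>)"
    by (simp add: norm_mult mult_left_le)
qed

lemma summable_mpow:
  fixes f :: "('k::finite \<Rightarrow> nat) \<Rightarrow> 'a::{real_normed_field, banach}"
  assumes "f abs_summable_on A" and "\<And>i. norm (z i) \<le> 1"
  shows "(\<lambda>\<alpha>. f \<alpha> * mpow z \<alpha>) summable_on A"
  by (rule abs_summable_summable) (rule abs_summable_mpow[OF assms])

text \<open>Variables are eliminated one at a time: the coefficients with \<open>\<alpha> k\<close> prescribed for
  \<open>k \<in> S\<close> still form a power series in the remaining variables that vanishes identically.\<close>

lemma mpow_series_eq_0_partial: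
  fixes f :: "('k::finite \<Rightarrow> nat) \<Rightarrow> complex"
  assumes f: "f abs_summable_on UNIV"
    and 0: "\<And>z. (\<And>i. norm (z i) \<le> 1) \<Longrightarrow> infsum (\<lambda>\<alpha>. f \<alpha> * mpow z \<alpha>) UNIV = 0"
    and "finite S" and "\<And>i. norm (z i) \<le> 1"
  shows "infsum (\<lambda>\<alpha>. f \<alpha> * (\<Prod>k\<in>-S. z k ^ \<alpha> k)) {\<alpha>. \<forall>k\<in>S. \<alpha> k = \<gamma> k} = 0"
  using assms(3,4)
proof (induction S arbitrary: z)
  case empty
  then show ?case using 0[of z] by (simp add: mpow_def)
next
  case (insert i S)
  let ?A = "{\<alpha>. \<forall>k\<in>S. \<alpha> k = \<gamma> k}" and ?B = "\<lambda>n. {\<alpha>. (\<forall>k\<in>S. \<alpha> k = \<gamma> k) \<and> \<alpha> i = n}"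
  let ?h = "\<lambda>\<alpha>. f \<alpha> * (\<Prod>k\<in>-insert i S. z k ^ \<alpha> k)"
  \<comment> \<open>With the \<open>i\<close>-th variable running through the unit disc and the
    others fixed, the series is a power series in that variable with n-th coefficient
    \<open>a n\<close>; the one-variable case then makes every \<open>a n\<close> vanish.\<close>
  define a where "a n = infsum ?h (?B n)" for n
  have cS: "- S = insert i (- insert i S)" using insert.hyps by auto
  have summ: "(\<lambda>\<alpha>. f \<alpha> * (\<Prod>k\<in>-T. w k ^ \<alpha> k)) summable_on X" if "\<And>k. norm (w k) \<le> 1" for T w X
  proof (rule abs_summable_summable, rule Infinite_Sum.abs_summable_on_comparison_test)
    show "f abs_summable_on X" by (rule summable_on_subset_banach[OF f]) auto
    fix \<alpha> :: "'k \<Rightarrow> nat"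
    have "norm (\<Prod>k\<in>-T. w k ^ \<alpha> k) \<le> 1"
      by (rule order_trans[OF norm_prod_le], rule prod_le_1) (auto simp: norm_power that power_le_one)
    then show "norm (f \<alpha> * (\<Prod>k\<in>-T. w k ^ \<alpha> k)) \<le> norm (f \<alpha>)"
      by (simp add: norm_mult mult_left_le)
  qed
  have "(\<lambda>n. a n * t ^ n) sums 0" if t: "norm t \<le> 1" for t
  proof -
    let ?w = "z(i := t)"
    let ?k = "\<lambda>\<alpha>. f \<alpha> * (\<Prod>k\<in>-S. ?w k ^ \<alpha> k)"
    have w: "norm (?w k) \<le> 1" for k using insert.prems t by simp
    have k: "?k \<alpha> = ?h \<alpha> * t ^ \<alpha> i" for \<alpha>
      unfolding cS by (subst prod.insert) (auto intro!: prod.cong)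
    have "(?k has_sum 0) ?A"
      using has_sum_infsum[OF summ[where w="?w" and T=S and X="?A"]] insert.IH[of ?w] w by simp
    moreover have "(?k has_sum 0) ?A \<longleftrightarrow> ((\<lambda>(n, \<alpha>). ?k \<alpha>) has_sum 0) (Sigma UNIV ?B)"
      by (rule has_sum_reindex_bij_witness[where i = snd and j = "\<lambda>\<alpha>. (\<alpha> i, \<alpha>)"]) auto
    ultimately have "((\<lambda>(n, \<alpha>). ?k \<alpha>) has_sum 0) (Sigma UNIV ?B)" by simp
    moreover have "(?k has_sum (a n * t ^ n)) (?B n)" for n
    proof -
      have "((\<lambda>\<alpha>. ?h \<alpha> * t ^ n) has_sum (a n * t ^ n)) (?B n)"
        unfolding a_def
        by (intro has_sum_cmult_left has_sum_infsum summ) (use insert.prems in auto)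
      then show ?thesis
        by (rule has_sum_cong[THEN iffD1, rotated]) (auto simp: k simp del: fun_upd_apply)
    qed
    ultimately have "((\<lambda>n. a n * t ^ n) has_sum 0) UNIV"
      by (intro has_sum_SigmaD[where f="\<lambda>(n, \<alpha>). ?k \<alpha>" and B="?B"]) auto
    then show ?thesis by (rule has_sum_imp_sums)
  qed
  then have "a (\<gamma> i) = 0"
    by (rule powser_eq_0_imp_coeff_0)
  moreover have "?B (\<gamma> i) = {\<alpha>. \<forall>k\<in>insert i S. \<alpha> k = \<gamma> k}"
    by auto
  ultimately show ?case
    by (simp add: a_def)
qed

lemma mpow_series_eq_0_imp_coeff_0:
  fixes f :: "('k::finite \<Rightarrow> nat) \<Rightarrow> complex"
  assumes "f abs_summable_on UNIV"
    and "\<And>z. (\<And>i. norm (z i) \<le> 1) \<Longrightarrow> infsum (\<lambda>\<alpha>. f \<alpha> * mpow z \<alpha>) UNIV = 0"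
  shows "f \<gamma> = 0"
proof -
  have "{\<alpha>. \<forall>k\<in>UNIV. \<alpha> k = \<gamma> k} = {\<gamma>}" by auto
  then show ?thesis
    using mpow_series_eq_0_partial[OF assms, of UNIV "\<lambda>_. 0" \<gamma>] by simp
qed

subsection \<open>The algebra of absolutely convergent power series\<close>

text \<open>The analytic Wiener algebra of the closed polydisc, represented by coefficients rather
  than by functions so that coefficient multipliers can be defined directly.\<close>

typedef 'm wiener = "{f :: ('m::finite \<Rightarrow> nat) \<Rightarrow> complex. f abs_summable_on UNIV}"
  morphisms wcoeff Wiener
  by (rule exI[of _ "\<lambda>_. 0"]) simp

setup_lifting type_definition_wiener

lemma wcoeff_abs_summable: "wcoeff f abs_summable_on A"
  using wcoeff[of f] by (auto intro: summable_on_subset_banach)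

lemma wcoeff_Wiener: "f abs_summable_on UNIV \<Longrightarrow> wcoeff (Wiener f) = f"
  by (simp add: Wiener_inverse)

lemma wiener_eqI: "(\<And>\<alpha>. wcoeff f \<alpha> = wcoeff g \<alpha>) \<Longrightarrow> f = g"
  by (metis ext wcoeff_inject)

lemma abs_summable_add:
  fixes f g :: "'a \<Rightarrow> 'b::real_normed_vector"
  assumes "f abs_summable_on A" "g abs_summable_on A"
  shows "(\<lambda>x. f x + g x) abs_summable_on A"
  by (rule Infinite_Sum.abs_summable_on_comparison_test'[OF summable_on_add[OF assms]])
     (rule norm_triangle_ineq)

lemma abs_summable_diff:
  fixes f g :: "'a \<Rightarrow> 'b::real_normed_vector"
  assumes "f abs_summable_on A" "g abs_summable_on A"
  shows "(\<lambda>x. f x - g x) abs_summable_on A"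
  using abs_summable_add[of f A "\<lambda>x. - g x"] assms by simp

instantiation wiener :: (finite) real_normed_vector
begin

lift_definition zero_wiener :: "'a wiener" is "\<lambda>_. 0"
  by simp

lift_definition plus_wiener :: "'a wiener \<Rightarrow> 'a wiener \<Rightarrow> 'a wiener" is "\<lambda>f g \<alpha>. f \<alpha> + g \<alpha>"
  by (simp add: abs_summable_add)

lift_definition uminus_wiener :: "'a wiener \<Rightarrow> 'a wiener" is "\<lambda>f \<alpha>. - f \<alpha>"
  by simp

lift_definition minus_wiener :: "'a wiener \<Rightarrow> 'a wiener \<Rightarrow> 'a wiener" is "\<lambda>f g \<alpha>. f \<alpha> - g \<alpha>"
  by (simp add: abs_summable_diff)

lift_definition scaleR_wiener :: "real \<Rightarrow> 'a wiener \<Rightarrow> 'a wiener" is "\<lambda>r f \<alpha>. r *\<^sub>R f \<alpha>"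
  by (simp add: summable_on_cmult_right)

definition norm_wiener :: "'a wiener \<Rightarrow> real" where
  "norm_wiener f = infsum (\<lambda>\<alpha>. norm (wcoeff f \<alpha>)) UNIV"

definition dist_wiener :: "'a wiener \<Rightarrow> 'a wiener \<Rightarrow> real" where
  "dist_wiener f g = norm (f - g)"

definition sgn_wiener :: "'a wiener \<Rightarrow> 'a wiener" where
  "sgn_wiener f = inverse (norm f) *\<^sub>R f"

definition uniformity_wiener :: "('a wiener \<times> 'a wiener) filter" where
  "uniformity_wiener = (INF e\<in>{0<..}. principal {(x, y). dist x y < e})"

definition open_wiener :: "'a wiener set \<Rightarrow> bool" where
  "open_wiener U \<longleftrightarrow> (\<forall>x\<in>U. \<forall>\<^sub>F (x', y) in uniformity. x' = x \<longrightarrow> y \<in> U)"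

instance
proof
  fix f g h :: "'a wiener" and r s :: real
  show "f + g + h = f + (g + h)" "f + g = g + f" "0 + f = f" "- f + f = 0" "f - g = f + - g"
    by (transfer; simp add: algebra_simps)+
  show "r *\<^sub>R (f + g) = r *\<^sub>R f + r *\<^sub>R g" "(r + s) *\<^sub>R f = r *\<^sub>R f + s *\<^sub>R f"
    "r *\<^sub>R s *\<^sub>R f = (r * s) *\<^sub>R f" "1 *\<^sub>R f = f"
    by (transfer; simp add: algebra_simps)+
  show "norm f = 0 \<longleftrightarrow> f = 0"
  proof
    assume "norm f = 0"
    then have "norm (wcoeff f \<alpha>) = 0" for \<alpha>
      unfolding norm_wiener_def
      by (intro nonneg_infsum_le_0D[of "\<lambda>\<alpha>. norm (wcoeff f \<alpha>)" UNIV])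
         (auto intro: wcoeff_abs_summable)
    then show "f = 0"
      by (intro wiener_eqI) (simp add: zero_wiener.rep_eq)
  qed (simp add: norm_wiener_def zero_wiener.rep_eq)
  show "norm (f + g) \<le> norm f + norm g"
    unfolding norm_wiener_def plus_wiener.rep_eq
    by (subst infsum_add[symmetric, OF wcoeff_abs_summable wcoeff_abs_summable])
       (intro infsum_mono abs_summable_add summable_on_add wcoeff_abs_summable norm_triangle_ineq)
  show "norm (r *\<^sub>R f) = \<bar>r\<bar> * norm f"
    unfolding norm_wiener_def scaleR_wiener.rep_eq by (simp add: infsum_cmult_right')
qed (rule dist_wiener_def sgn_wiener_def uniformity_wiener_def open_wiener_def)+

end

lemmas wcoeff_simps [simp] =
  zero_wiener.rep_eq plus_wiener.rep_eq minus_wiener.rep_eq uminus_wiener.rep_eq scaleR_wiener.rep_eq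

lemma norm_wcoeff_le: "norm (wcoeff f \<alpha>) \<le> norm f"
  unfolding norm_wiener_def
  using finite_sum_le_infsum[OF wcoeff_abs_summable, of "{\<alpha>}" UNIV f] by simp

lemma norm_wiener_le:
  assumes "\<And>F. finite F \<Longrightarrow> (\<Sum>\<alpha>\<in>F. norm (wcoeff f \<alpha>)) \<le> c"
  shows "norm f \<le> c"
  unfolding norm_wiener_def by (rule infsum_le_finite_sums) (auto intro: wcoeff_abs_summable assms)

lemma sum_norm_wcoeff_le: "finite F \<Longrightarrow> (\<Sum>\<alpha>\<in>F. norm (wcoeff f \<alpha>)) \<le> norm f"
  unfolding norm_wiener_def by (rule finite_sum_le_infsum) (auto intro: wcoeff_abs_summable)

lemma bounded_linear_wcoeff: "bounded_linear (\<lambda>f. wcoeff f \<alpha>)"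
  by (rule bounded_linear_intro[where K=1]) (auto intro: norm_wcoeff_le)

instance wiener :: (finite) banach
proof
  fix X :: "nat \<Rightarrow> 'a wiener"
  assume X: "Cauchy X"
  have "convergent (\<lambda>n. wcoeff (X n) \<alpha>)" for \<alpha>
    using bounded_linear.Cauchy[OF bounded_linear_wcoeff X] by (rule Cauchy_convergent)
  then obtain g where g: "\<And>\<alpha>. (\<lambda>n. wcoeff (X n) \<alpha>) \<longlonglongrightarrow> g \<alpha>"
    unfolding convergent_def by metis
  \<comment> \<open>A bound on finite partial sums survives the coefficientwise limit, and the norm
    is the supremum of these sums; no limit has to be exchanged with an infinite sum.\<close>
  have bound: "(\<Sum>\<alpha>\<in>F. norm (wcoeff (X n) \<alpha> - g \<alpha>)) \<le> e"
    if "finite F" "\<And>m. m \<ge> n \<Longrightarrow> norm (X n - X m) \<le> e" for F n e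
  proof (rule LIMSEQ_le_const2)
    show "(\<lambda>m. \<Sum>\<alpha>\<in>F. norm (wcoeff (X n) \<alpha> - wcoeff (X m) \<alpha>)) \<longlonglongrightarrow> (\<Sum>\<alpha>\<in>F. norm (wcoeff (X n) \<alpha> - g \<alpha>))"
      by (intro tendsto_intros g)
    show "\<exists>N. \<forall>m\<ge>N. (\<Sum>\<alpha>\<in>F. norm (wcoeff (X n) \<alpha> - wcoeff (X m) \<alpha>)) \<le> e"
      using sum_norm_wcoeff_le[OF that(1), of "X n - X m" for m] that(2)
      by (intro exI[of _ n]) (auto intro: order_trans)
  qed
  have tail: "\<exists>N. \<forall>n\<ge>N. \<forall>m\<ge>n. norm (X n - X m) \<le> e" if "e > 0" for e
    using CauchyD[OF X that] by (meson le_trans less_imp_le)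
  obtain N where N: "\<And>m. m \<ge> N \<Longrightarrow> norm (X N - X m) \<le> 1"
    using tail[of 1] by auto
  have "(\<lambda>\<alpha>. wcoeff (X N) \<alpha> - g \<alpha>) abs_summable_on UNIV"
    unfolding abs_summable_iff_bdd_above using bound[OF _ N] by (auto intro!: bdd_aboveI2[where M=1])
  \<comment> \<open>The sum of the two families is - \<open>g\<close>, which has the same norms as
    \<open>g\<close>.\<close>
  from abs_summable_add[OF wcoeff_abs_summable[of "- X N"] this]
  have "g abs_summable_on UNIV" by simp
  then have G: "wcoeff (Wiener g) = g" by (rule wcoeff_Wiener)
  have "X \<longlonglongrightarrow> Wiener g"
  proof (rule LIMSEQ_I)
    fix e :: real assume "0 < e"
    then obtain N where N: "\<And>n m. n \<ge> N \<Longrightarrow> m \<ge> n \<Longrightarrow> norm (X n - X m) \<le> e / 2"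
      using tail[of "e / 2"] by auto
    have "norm (X n - Wiener g) \<le> e / 2" if "n \<ge> N" for n
      using bound[OF _ N[OF that]] by (intro norm_wiener_le) (simp add: G)
    with \<open>0 < e\<close> show "\<exists>N. \<forall>n\<ge>N. norm (X n - Wiener g) < e"
      by (intro exI[of _ N]) fastforce
  qed
  then show "convergent X" by (rule convergentI)
qed

section \<open>Evaluation at points of the closed unit polydisc\<close>

definition weval :: "('m \<Rightarrow> complex) \<Rightarrow> 'm::finite wiener \<Rightarrow> complex" where
  "weval z f = infsum (\<lambda>\<alpha>. wcoeff f \<alpha> * mpow z \<alpha>) UNIV"

abbreviation unit_polydisc :: "('m \<Rightarrow> complex) set" where
  "unit_polydisc \<equiv> {z. \<forall>i. norm (z i) \<le> 1}"

lemma weval_summable: "z \<in> unit_polydisc \<Longrightarrow> (\<lambda>\<alpha>. wcoeff f \<alpha> * mpow z \<alpha>) summable_on A"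
  by (auto intro: summable_mpow wcoeff_abs_summable)

lemma weval_has_sum:
  "z \<in> unit_polydisc \<Longrightarrow> ((\<lambda>\<alpha>. wcoeff f \<alpha> * mpow z \<alpha>) has_sum weval z f) UNIV"
  unfolding weval_def by (intro has_sum_infsum weval_summable)

lemma norm_weval_le:
  assumes "z \<in> unit_polydisc"
  shows "norm (weval z f) \<le> norm f"
proof (rule norm_infsum_le[OF weval_has_sum[OF assms]])
  show "((\<lambda>\<alpha>. norm (wcoeff f \<alpha>)) has_sum norm f) UNIV"
    unfolding norm_wiener_def by (intro has_sum_infsum wcoeff_abs_summable)
  fix \<alpha> :: "'a \<Rightarrow> nat"
  have "norm (mpow z \<alpha>) \<le> 1"
    using norm_mpow_le_power[of z 1 \<alpha>] assms by simp
  then show "norm (wcoeff f \<alpha> * mpow z \<alpha>) \<le> norm (wcoeff f \<alpha>)"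
    by (simp add: norm_mult mult_left_le)
qed

lemma weval_add:
  assumes "z \<in> unit_polydisc" shows "weval z (f + g) = weval z f + weval z g"
  unfolding weval_def plus_wiener.rep_eq distrib_right
  by (rule infsum_add) (rule weval_summable[OF assms])+

lemma weval_scaleR: "weval z (r *\<^sub>R f) = r *\<^sub>R weval z f"
  unfolding weval_def scaleR_wiener.rep_eq mult_scaleR_left by (rule infsum_scaleR_right)

lemma bounded_linear_weval: "z \<in> unit_polydisc \<Longrightarrow> bounded_linear (weval z)"
  by (rule bounded_linear_intro[where K=1])
     (auto simp: weval_add weval_scaleR intro: norm_weval_le)

text \<open>The uniqueness of coefficients in the form used from here on: identities in the algebra,
  such as the ring laws or the vanishing of \<open>Zhat q\<close>, may be checked pointwise.\<close>

lemma weval_inject: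
  assumes "\<And>z. z \<in> unit_polydisc \<Longrightarrow> weval z f = weval z g"
  shows "f = g"
proof (rule wiener_eqI)
  fix \<alpha>
  have "wcoeff (f - g) \<alpha> = 0"
  proof (rule mpow_series_eq_0_imp_coeff_0[OF wcoeff_abs_summable])
    fix z :: "'a \<Rightarrow> complex" assume "\<And>i. norm (z i) \<le> 1"
    then have z: "z \<in> unit_polydisc" by simp
    show "infsum (\<lambda>\<alpha>. wcoeff (f - g) \<alpha> * mpow z \<alpha>) UNIV = 0"
      using assms[OF z] linear_diff[OF bounded_linear.linear[OF bounded_linear_weval[OF z]], of f g]
      by (simp add: weval_def)
  qed
  then show "wcoeff f \<alpha> = wcoeff g \<alpha>" by simp
qed

instantiation wiener :: (finite) "{comm_ring_1, real_normed_algebra_1}"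
begin

lift_definition one_wiener :: "'a wiener" is "\<lambda>\<alpha>. if \<alpha> = (\<lambda>_. 0) then 1 else 0"
  by (auto intro!: finite_nonzero_values_imp_summable_on simp: if_distrib)

lift_definition times_wiener :: "'a wiener \<Rightarrow> 'a wiener \<Rightarrow> 'a wiener" is conv
  by (simp add: conv_abs_summable)

lemma weval_one: "weval z (1 :: 'a wiener) = 1"
proof -
  have "((\<lambda>\<alpha>. wcoeff 1 \<alpha> * mpow z \<alpha>) has_sum 1) UNIV"
    by (rule has_sum_finite_neutralI[of "{\<lambda>_. 0}"]) (auto simp: one_wiener.rep_eq)
  then show ?thesis
    unfolding weval_def by (rule infsumI)
qed

text \<open>Proved while \<open>*\<close> is still bare convolution, since the ring laws rest on it.
  Weighting the coefficients by \<open>mpow z\<close> commutes with convolution, so the Cauchy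
  product theorem applies.\<close>

lemma weval_mult:
  fixes f g :: "'a wiener"
  assumes z: "z \<in> unit_polydisc"
  shows "weval z (f * g) = weval z f * weval z g"
proof -
  have "conv (\<lambda>\<alpha>. wcoeff f \<alpha> * mpow z \<alpha>) (\<lambda>\<alpha>. wcoeff g \<alpha> * mpow z \<alpha>)
      = (\<lambda>\<alpha>. wcoeff (f * g) \<alpha> * mpow z \<alpha>)"
    by (rule ext) (simp add: conv_mpow times_wiener.rep_eq)
  moreover have "(conv (\<lambda>\<alpha>. wcoeff f \<alpha> * mpow z \<alpha>) (\<lambda>\<alpha>. wcoeff g \<alpha> * mpow z \<alpha>)
      has_sum (weval z f * weval z g)) UNIV"
    unfolding weval_def
    by (intro conv_has_sum abs_summable_mpow wcoeff_abs_summable) (use z in auto)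
  ultimately show ?thesis
    unfolding weval_def[of z "f * g"] by (simp add: infsumI)
qed

text \<open>Evaluation separates points, so the ring laws are inherited from the complex numbers.\<close>

instance
proof
  fix f g h :: "'a wiener" and r :: real
  note weval_hom = weval_mult weval_add weval_scaleR weval_one
  show "f * g * h = f * (g * h)" "f * g = g * f" "1 * f = f" "f * 1 = f" "(f + g) * h = f * h + g * h"
    "f * (g + h) = f * g + f * h"
    "r *\<^sub>R f * g = r *\<^sub>R (f * g)" "f * r *\<^sub>R g = r *\<^sub>R (f * g)"
    by (rule weval_inject; simp add: weval_hom algebra_simps)+
  have "wcoeff (0::'a wiener) (\<lambda>_. 0) \<noteq> wcoeff 1 (\<lambda>_. 0)"
    by (simp add: one_wiener.rep_eq)
  then show "(0::'a wiener) \<noteq> 1" by metis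
  have "((\<lambda>\<alpha>. norm (wcoeff (1::'a wiener) \<alpha>)) has_sum 1) UNIV"
    by (rule has_sum_finite_neutralI[of "{\<lambda>_. 0}"]) (auto simp: one_wiener.rep_eq)
  then show "norm (1::'a wiener) = 1"
    unfolding norm_wiener_def by (rule infsumI)
  have *: "(conv (\<lambda>\<alpha>. norm (wcoeff f \<alpha>)) (\<lambda>\<alpha>. norm (wcoeff g \<alpha>)) has_sum (norm f * norm g)) UNIV"
    unfolding norm_wiener_def by (intro conv_norm_has_sum wcoeff_abs_summable)
  show "norm (f * g) \<le> norm f * norm g"
    unfolding norm_wiener_def[of "f * g"]
    by (rule has_sum_mono[OF has_sum_infsum * ])
       (auto simp: times_wiener.rep_eq intro: norm_conv_le wcoeff_abs_summable conv_abs_summable)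
qed

end

subsection \<open>Substitution, re-expansion and differentiation\<close>

lemma zero_in_unit_polydisc [simp]: "(\<lambda>_. 0) \<in> unit_polydisc"
  by simp

lemma weval_0: "weval (\<lambda>_. 0) f = wcoeff f (\<lambda>_. 0)"
  unfolding weval_def
  by (rule infsumI, rule has_sum_finite_neutralI[of "{\<lambda>_. 0}"]) (auto simp: mpow_0)

lemma weval_power: "z \<in> unit_polydisc \<Longrightarrow> weval z (f ^ n) = weval z f ^ n"
  by (induction n) (simp_all add: weval_one weval_mult)

lemma weval_mpow:
  assumes "z \<in> unit_polydisc"
  shows "weval z (mpow x \<alpha>) = mpow (\<lambda>k. weval z (x k)) \<alpha>"
proof -
  have "weval z (\<Prod>k\<in>S. x k ^ \<alpha> k) = (\<Prod>k\<in>S. weval z (x k) ^ \<alpha> k)" if "finite S" for S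
    using that assms by (induction S) (simp_all add: weval_one weval_mult weval_power)
  then show ?thesis by (simp add: mpow_def)
qed

lift_definition wmonom :: "('m::finite \<Rightarrow> nat) \<Rightarrow> complex \<Rightarrow> 'm wiener" is
  "\<lambda>\<beta> c \<alpha>. if \<alpha> = \<beta> then c else 0"
  by (auto intro!: finite_nonzero_values_imp_summable_on simp: if_distrib)

lemma weval_wmonom: "weval z (wmonom \<beta> c) = c * mpow z \<beta>"
  unfolding weval_def
  by (rule infsumI, rule has_sum_finite_neutralI[of "{\<beta>}"]) (auto simp: wmonom.rep_eq)

lemma norm_wmonom: "norm (wmonom \<beta> c) = norm c"
  unfolding norm_wiener_def
  by (rule infsumI, rule has_sum_finite_neutralI[of "{\<beta>}"]) (auto simp: wmonom.rep_eq)

text \<open>The type classes at hand supply only real scalars, so complex scalars act through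
  multiplication by constant series.\<close>

abbreviation wconst :: "complex \<Rightarrow> 'm::finite wiener" where
  "wconst \<equiv> wmonom (\<lambda>_. 0)"

lemma weval_wconst [simp]: "weval z (wconst c) = c"
  by (simp add: weval_wmonom)

lemma wcoeff_wconst_mult: "wcoeff (wconst c * f) \<alpha> = c * wcoeff f \<alpha>"
proof -
  have "wcoeff (wconst c * f) \<alpha> = (\<Sum>\<beta>\<in>{..\<alpha>}. if \<beta> = (\<lambda>_. 0) then c * wcoeff f \<alpha> else 0)"
    unfolding times_wiener.rep_eq conv_def by (rule sum.cong) (auto simp: wmonom.rep_eq)
  then show ?thesis
    by (simp add: le_fun_def)
qed

text \<open>Junk value: \<open>multiplier m f\<close> is only meaningful for bounded \<open>m\<close>.\<close>

definition multiplier :: "(('m::finite \<Rightarrow> nat) \<Rightarrow> complex) \<Rightarrow> 'm wiener \<Rightarrow> 'm wiener" where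
  "multiplier m f = Wiener (\<lambda>\<alpha>. m \<alpha> * wcoeff f \<alpha>)"

lemma wcoeff_multiplier:
  assumes "\<And>\<alpha>. norm (m \<alpha>) \<le> K"
  shows "wcoeff (multiplier m f) \<alpha> = m \<alpha> * wcoeff f \<alpha>"
proof -
  have "(\<lambda>\<alpha>. m \<alpha> * wcoeff f \<alpha>) abs_summable_on UNIV"
    by (rule Infinite_Sum.abs_summable_on_comparison_test'
        [OF summable_on_cmult_right[OF wcoeff_abs_summable[of f], of K]])
       (simp add: norm_mult mult_right_mono assms)
  then show ?thesis
    by (simp add: multiplier_def wcoeff_Wiener)
qed

lemma norm_multiplier_le:
  assumes m: "\<And>\<alpha>. norm (m \<alpha>) \<le> K"
  shows "norm (multiplier m f) \<le> K * norm f"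
proof (rule norm_wiener_le)
  fix F :: "('a \<Rightarrow> nat) set" assume F: "finite F"
  have K: "0 \<le> K" using m norm_ge_zero order_trans by blast
  have "(\<Sum>\<alpha>\<in>F. norm (wcoeff (multiplier m f) \<alpha>)) \<le> (\<Sum>\<alpha>\<in>F. K * norm (wcoeff f \<alpha>))"
    by (rule sum_mono) (simp add: wcoeff_multiplier[OF m] norm_mult mult_right_mono m)
  also have "\<dots> \<le> K * norm f"
    unfolding sum_distrib_left[symmetric] by (rule mult_left_mono[OF sum_norm_wcoeff_le[OF F] K])
  finally show "(\<Sum>\<alpha>\<in>F. norm (wcoeff (multiplier m f) \<alpha>)) \<le> K * norm f" .
qed

lemma multiplier_diff:
  assumes m: "\<And>\<alpha>. norm (m \<alpha>) \<le> K"
  shows "multiplier m (f - g) = multiplier m f - multiplier m g"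
  by (rule wiener_eqI) (simp add: wcoeff_multiplier[OF m] algebra_simps)

definition wsubst :: "(('k::finite \<Rightarrow> nat) \<Rightarrow> complex) \<Rightarrow> ('k \<Rightarrow> 'm wiener) \<Rightarrow> 'm::finite wiener" where
  "wsubst c x = infsum (\<lambda>\<alpha>. wconst (c \<alpha>) * mpow x \<alpha>) UNIV"

text \<open>Evaluation is bounded, linear and multiplicative, so it passes through the infinite sum
  and through each monomial. Substitution in the algebra thus is composition of functions.\<close>

lemma weval_wsubst:
  fixes x :: "'k::finite \<Rightarrow> 'm::finite wiener"
  assumes c: "(\<lambda>\<alpha>. norm (c \<alpha>) * s ^ mdeg \<alpha>) summable_on UNIV" and x: "\<And>k. norm (x k) \<le> s"
    and z: "z \<in> unit_polydisc"
  shows "((\<lambda>\<alpha>. c \<alpha> * mpow (\<lambda>k. weval z (x k)) \<alpha>) has_sum weval z (wsubst c x)) UNIV"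
proof -
  have "((\<lambda>\<alpha>. wconst (c \<alpha>) * mpow x \<alpha>) has_sum wsubst c x) UNIV"
    unfolding wsubst_def
    by (intro has_sum_infsum mpow_series_summable[where s=s]) (use c x in \<open>auto simp: norm_wmonom\<close>)
  from has_sum_bounded_linear[OF bounded_linear_weval[OF z] this] show ?thesis
    using z by (simp add: weval_mult weval_mpow)
qed

lemma wsubst_expand:
  fixes x :: "'k::finite \<Rightarrow> 'm::finite wiener"
  assumes c: "(\<lambda>\<alpha>. norm (c \<alpha>) * s ^ mdeg \<alpha>) summable_on UNIV" and x: "\<And>k. norm (x k) \<le> s"
  shows "wsubst c x = wconst (c (\<lambda>_. 0)) + (\<Sum>k\<in>UNIV. wconst (c (unit_index k)) * x k)
    + tail_series (\<lambda>\<alpha>. wconst (c \<alpha>)) x"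
  unfolding wsubst_def
  by (intro infsumI mpow_series_has_sum[where s=s]) (use c x in \<open>auto simp: norm_wmonom\<close>)

text \<open>Two indices adding up to degree at most 1 cannot both be nonzero, so every term of the
  convolution contains a constant coefficient.\<close>

lemma wcoeff_mult_eq_0:
  assumes f: "wcoeff f (\<lambda>_. 0) = 0" and g: "wcoeff g (\<lambda>_. 0) = 0" and \<alpha>: "mdeg \<alpha> \<le> 1"
  shows "wcoeff (f * g) \<alpha> = 0"
  unfolding times_wiener.rep_eq conv_def
proof (rule sum.neutral, rule ballI)
  fix \<beta> assume "\<beta> \<in> {..\<alpha>}"
  then have "\<alpha> = (\<lambda>i. \<beta> i + (\<alpha> i - \<beta> i))"
    by (simp add: le_fun_def)
  then have "mdeg \<beta> + mdeg (\<lambda>i. \<alpha> i - \<beta> i) \<le> 1"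
    using \<alpha> by (metis mdeg_add)
  then have "\<beta> = (\<lambda>_. 0) \<or> (\<lambda>i. \<alpha> i - \<beta> i) = (\<lambda>_. 0)"
    unfolding mdeg_0_iff[symmetric] by linarith
  then show "wcoeff f \<beta> * wcoeff g (\<lambda>i. \<alpha> i - \<beta> i) = 0"
    using f g by (metis mult_zero_left mult_zero_right)
qed

text \<open>A monomial of degree at least two splits into one variable and a monomial of positive
  degree, hence into two elements without constant term. This is why the nonlinear part does not
  disturb degrees 0 and 1.\<close>

lemma wcoeff_tail_series_eq_0:
  fixes x :: "'k::finite \<Rightarrow> 'm::finite wiener"
  assumes c: "(\<lambda>\<alpha>. norm (c \<alpha>) * s ^ mdeg \<alpha>) summable_on UNIV" and x: "\<And>k. norm (x k) \<le> s"
    and 0: "\<And>k. wcoeff (x k) (\<lambda>_. 0) = 0" and \<alpha>: "mdeg \<alpha> \<le> 1"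
  shows "wcoeff (tail_series (\<lambda>\<alpha>. wconst (c \<alpha>)) x) \<alpha> = 0"
proof -
  have term0: "wcoeff (wconst (c \<beta>) * mpow x \<beta>) \<alpha> = 0" if \<beta>: "2 \<le> mdeg \<beta>" for \<beta>
  proof -
    have "\<beta> \<noteq> (\<lambda>_. 0)" using \<beta> by auto
    then obtain k where "\<beta> k \<noteq> 0" by auto
    then obtain \<gamma> where \<gamma>: "\<beta> = (\<lambda>i. unit_index k i + \<gamma> i)"
      using unit_index_split by metis
    have "mdeg \<beta> = 1 + mdeg \<gamma>"
      unfolding \<gamma> mdeg_add by simp
    then have "mdeg \<gamma> \<noteq> 0" using \<beta> by simp
    \<comment> \<open>The constant coefficient is evaluation at 0 and therefore
      multiplicative.\<close>
    moreover have "wcoeff (mpow x \<gamma>) (\<lambda>_. 0) = mpow (\<lambda>k. wcoeff (x k) (\<lambda>_. 0)) \<gamma>"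
      by (simp only: weval_0[symmetric] weval_mpow[OF zero_in_unit_polydisc])
    ultimately have "wcoeff (mpow x \<gamma>) (\<lambda>_. 0) = 0"
      by (simp add: 0 mpow_const power_0_left)
    moreover have "wcoeff (wconst (c \<beta>) * x k) (\<lambda>_. 0) = 0"
      by (simp add: wcoeff_wconst_mult 0)
    ultimately have "wcoeff (wconst (c \<beta>) * x k * mpow x \<gamma>) \<alpha> = 0"
      by (intro wcoeff_mult_eq_0[OF _ _ \<alpha>])
    moreover have "mpow x \<beta> = x k * mpow x \<gamma>"
      unfolding \<gamma> mpow_add by simp
    ultimately show ?thesis by (simp add: mult.assoc)
  qed
  have "((\<lambda>\<beta>. wconst (c \<beta>) * mpow x \<beta>) has_sum tail_series (\<lambda>\<alpha>. wconst (c \<alpha>)) x) {\<beta>. 2 \<le> mdeg \<beta>}"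
    unfolding tail_series_def
    by (intro has_sum_infsum mpow_series_summable[where s=s]) (use c x in \<open>auto simp: norm_wmonom\<close>)
  from has_sum_bounded_linear[OF bounded_linear_wcoeff[of \<alpha>] this]
  have "((\<lambda>\<beta>. 0) has_sum wcoeff (tail_series (\<lambda>\<alpha>. wconst (c \<alpha>)) x) \<alpha>) {\<beta> :: 'k \<Rightarrow> nat. 2 \<le> mdeg \<beta>}"
    by (rule has_sum_cong[THEN iffD1, rotated]) (simp add: term0)
  then show ?thesis
    using has_sum_0_simp has_sum_unique by blast
qed

section \<open>Vector-valued series: analyticity and the derivative at 0\<close>

lemma has_sum_vecI:
  fixes f :: "'a \<Rightarrow> 'b::real_normed_vector^'n"
  assumes "\<And>r. ((\<lambda>x. f x $ r) has_sum (S $ r)) A"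
  shows "(f has_sum S) A"
  using assms unfolding has_sum_def by (intro vec_tendstoI) simp

lemma has_sum_vec_nth:
  fixes f :: "'a \<Rightarrow> 'b::real_normed_vector^'n"
  shows "(f has_sum S) A \<Longrightarrow> ((\<lambda>x. f x $ r) has_sum (S $ r)) A"
  by (rule has_sum_bounded_linear[OF bounded_linear_vec_nth])

lemma norm_vec_le_sum:
  fixes x :: "'a::real_normed_vector^'n"
  shows "norm x \<le> (\<Sum>i\<in>UNIV. norm (x $ i))"
  by (simp add: norm_vec_def L2_set_le_sum)

lemma norm_vec_le_card:
  fixes x :: "'a::real_normed_vector^'n"
  assumes "\<And>i. norm (x $ i) \<le> c"
  shows "norm x \<le> real CARD('n) * c"
  by (rule order_trans[OF norm_vec_le_sum]) (use sum_bounded_above[of UNIV "\<lambda>i. norm (x $ i)" c] assms in simp)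

text \<open>Re-expansion at \<open>a\<close> amounts to substituting the elements \<open>a\<^sub>i + r X\<^sub>i\<close> of the algebra,
  whose norm is at most 1.\<close>

lemma vec_analytic_on_weval:
  fixes p :: "'m::finite wiener^'d"
  assumes s: "0 < s"
  shows "vec_analytic_on (\<lambda>z. \<chi> r. weval (\<lambda>i. z $ i / of_real s) (p $ r)) (ball 0 s)"
  unfolding vec_analytic_on_def
proof (intro conjI ballI)
  fix a :: "complex^'m" assume a: "a \<in> ball 0 s"
  \<comment> \<open>The distance from \<open>a\<close> to the sphere of radius \<open>s\<close>,
    chosen to turn |a| / s + \<rho> / s into exactly 1 in the norm bound for
    \<open>x i\<close>.\<close>
  define \<rho> where "\<rho> = s - norm a"
  have \<rho>: "0 < \<rho>" using a by (simp add: \<rho>_def)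
  define x where "x i = wconst (a $ i / of_real s) + wmonom (unit_index i) (of_real (\<rho> / s))" for i :: 'm
  have wx: "weval w (x i) = a $ i / of_real s + of_real (\<rho> / s) * w i" if "w \<in> unit_polydisc" for w i
    using that by (simp add: x_def weval_add weval_wmonom)
  have nx: "norm (x i) \<le> 1" for i
  proof -
    have "norm (x i) \<le> norm (a $ i) / s + \<rho> / s"
      unfolding x_def using s \<rho>
      by (intro order_trans[OF norm_triangle_ineq]) (simp add: norm_wmonom norm_divide)
    also have "\<dots> \<le> norm a / s + \<rho> / s"
      using s by (intro add_right_mono divide_right_mono Finite_Cartesian_Product.norm_nth_le) auto
    also have "\<dots> = 1"
      using s by (simp add: \<rho>_def field_simps)
    finally show ?thesis .
  qed
  define q where "q r = wsubst (wcoeff (p $ r)) x" for r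
  define c :: "('m \<Rightarrow> nat) \<Rightarrow> complex^'d" where
    "c \<alpha> = (\<chi> r. wcoeff (q r) \<alpha> / of_real \<rho> ^ mdeg \<alpha>)" for \<alpha>
  have "((\<lambda>\<alpha>. (\<Prod>i\<in>UNIV. (z $ i - a $ i) ^ \<alpha> i) *s c \<alpha>) has_sum
      (\<chi> r. weval (\<lambda>i. z $ i / of_real s) (p $ r))) UNIV" if z: "z \<in> ball a \<rho>" for z
  proof (rule has_sum_vecI)
    fix r
    define w where "w i = (z $ i - a $ i) / of_real \<rho>" for i
    have "norm (z $ i - a $ i) \<le> \<rho>" for i
      using Finite_Cartesian_Product.norm_nth_le[of "z - a" i] z by (simp add: dist_norm norm_minus_commute)
    then have w: "w \<in> unit_polydisc"
      using \<rho> by (simp add: w_def norm_divide)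
    have xw: "weval w (x i) = z $ i / of_real s" for i
      unfolding wx[OF w] using s \<rho> by (simp add: w_def field_simps)
    have "((\<lambda>\<alpha>. wcoeff (p $ r) \<alpha> * mpow (\<lambda>i. z $ i / of_real s) \<alpha>) has_sum weval w (q r)) UNIV"
      unfolding q_def xw[symmetric]
      by (rule weval_wsubst[where s=1]) (use nx w in \<open>auto intro: wcoeff_abs_summable\<close>)
    then have "weval w (q r) = weval (\<lambda>i. z $ i / of_real s) (p $ r)"
      unfolding weval_def[of "\<lambda>i. z $ i / of_real s"] by (rule infsumI[symmetric])
    moreover have "((\<lambda>\<alpha>. wcoeff (q r) \<alpha> * mpow w \<alpha>) has_sum weval w (q r)) UNIV"
      by (rule weval_has_sum[OF w])
    moreover have "wcoeff (q r) \<alpha> * mpow w \<alpha> = ((\<Prod>i\<in>UNIV. (z $ i - a $ i) ^ \<alpha> i) *s c \<alpha>) $ r" for \<alpha>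
    proof -
      have "mpow (\<lambda>i. z $ i - a $ i) \<alpha> = mpow (\<lambda>i. of_real \<rho> * w i) \<alpha>"
        using \<rho> by (simp add: w_def)
      then have "(\<Prod>i\<in>UNIV. (z $ i - a $ i) ^ \<alpha> i) = of_real \<rho> ^ mdeg \<alpha> * mpow w \<alpha>"
        by (simp add: mpow_mult mpow_const flip: mpow_def)
      then show ?thesis using \<rho> by (simp add: c_def)
    qed
    ultimately show "((\<lambda>\<alpha>. ((\<Prod>i\<in>UNIV. (z $ i - a $ i) ^ \<alpha> i) *s c \<alpha>) $ r) has_sum
      ((\<chi> r. weval (\<lambda>i. z $ i / of_real s) (p $ r)) $ r)) UNIV" by simp
  qed
  then show "\<exists>r>0. \<exists>c :: ('m \<Rightarrow> nat) \<Rightarrow> complex^'d. \<forall>z\<in>ball a r.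
      ((\<lambda>\<alpha>. (\<Prod>i\<in>UNIV. (z $ i - a $ i) ^ \<alpha> i) *s c \<alpha>) has_sum
       (\<chi> r. weval (\<lambda>i. z $ i / of_real s) (p $ r))) UNIV"
    using \<rho> by blast
qed simp

text \<open>The Lipschitz estimate for the tail, taken between y and 0 with radius and distance both
  equal to |y|, is quadratic in |y|. Uniqueness of derivatives then lets linear coefficients be read
  off.\<close>

lemma mpow_series_has_derivative:
  fixes c :: "('n::finite \<Rightarrow> nat) \<Rightarrow> complex" and F :: "complex^'n \<Rightarrow> complex"
  assumes c: "(\<lambda>\<alpha>. norm (c \<alpha>) * s ^ mdeg \<alpha>) summable_on UNIV" and s: "0 < s" and \<rho>: "0 < \<rho>"
    and F: "\<And>x. norm x < \<rho> \<Longrightarrow> ((\<lambda>\<alpha>. c \<alpha> * mpow (\<lambda>k. x $ k) \<alpha>) has_sum F x) UNIV"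
  shows "(F has_derivative (\<lambda>x. \<Sum>k\<in>UNIV. c (unit_index k) * x $ k)) (at 0)"
  unfolding has_derivative_at_alt
proof (intro conjI allI impI)
  let ?L = "\<lambda>x :: complex^'n. \<Sum>k\<in>UNIV. c (unit_index k) * x $ k"
  show "bounded_linear ?L"
    by (intro bounded_linear_sum bounded_linear_const_mult bounded_linear_vec_nth)
  define M where "M = infsum (\<lambda>\<alpha>. norm (c \<alpha>) * s ^ mdeg \<alpha>) UNIV"
  have M: "0 \<le> M" unfolding M_def using s by (intro infsum_nonneg) simp
  have expand: "F x = c (\<lambda>_. 0) + ?L x + tail_series c (\<lambda>k. x $ k)" if "norm x < \<rho>" "norm x \<le> s" for x
    using that order_trans[OF Finite_Cartesian_Product.norm_nth_le[of x] that(2)]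
    by (intro has_sum_unique[OF F mpow_series_has_sum[OF c]])
  have bound: "norm (F y - F 0 - ?L (y - 0)) \<le> (M * 2 / s\<^sup>2 * norm y) * norm y"
    if y: "norm y < \<rho>" "2 * norm y \<le> s" for y
  proof -
    have "norm y \<le> s" using y(2) norm_ge_zero[of y] by linarith
    then have "F y - F 0 - ?L (y - 0) = tail_series c (\<lambda>k. y $ k) - tail_series c (\<lambda>k. 0)"
      using expand[of y] expand[of 0] y \<rho> s by simp
    also have "norm \<dots> \<le> M * (2 * norm y / s\<^sup>2 * norm y)"
      unfolding M_def
      by (rule tail_series_lipschitz[OF c s y(2)]) (auto intro: Finite_Cartesian_Product.norm_nth_le)
    finally show ?thesis by (simp add: mult_ac)
  qed
  fix e :: real assume e: "0 < e"
  \<comment> \<open>The summand 1 keeps the denominator positive even if M = 0.\<close>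
  define d where "d = Min {\<rho>, s / 2, e / (M * 2 / s\<^sup>2 + 1)}"
  have K: "0 < M * 2 / s\<^sup>2 + 1" using M s by (intro add_nonneg_pos) auto
  have "0 < d" using \<rho> s e K by (simp add: d_def)
  moreover have "norm (F y - F 0 - ?L (y - 0)) \<le> e * norm (y - 0)" if "norm (y - 0) < d" for y
  proof -
    have y: "norm y < \<rho>" "2 * norm y \<le> s" "norm y < e / (M * 2 / s\<^sup>2 + 1)"
      using that by (auto simp: d_def)
    have "M * 2 / s\<^sup>2 * norm y \<le> (M * 2 / s\<^sup>2 + 1) * norm y"
      by (rule mult_right_mono) auto
    also have "\<dots> \<le> e"
      using y(3) K by (simp add: pos_less_divide_eq mult.commute)
    finally show ?thesis
      using order_trans[OF bound[OF y(1,2)] mult_right_mono[of _ e "norm y"]] by simp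
  qed
  ultimately show "\<exists>d>0. \<forall>y. norm (y - 0) < d \<longrightarrow> norm (F y - F 0 - ?L (y - 0)) \<le> e * norm (y - 0)"
    by blast
qed

subsection \<open>The fixed point equation\<close>

lemma finite_mdeg_less: "finite {\<alpha> :: 'k::finite \<Rightarrow> nat. mdeg \<alpha> < n}"
proof (rule finite_subset)
  show "{\<alpha> :: 'k \<Rightarrow> nat. mdeg \<alpha> < n} \<subseteq> {..\<lambda>_. n}"
    by (auto simp: le_fun_def) (meson le_less_trans less_imp_le mdeg_ge)
qed simp

text \<open>Since \<lambda>^\<alpha> tends to 0 with growing degree, continuity at 0 controls all
  but finitely many \<alpha>, and the remaining values are simply added to the bound.\<close>

lemma bounded_along_powers:
  fixes f :: "complex \<Rightarrow> complex" and lam :: "'m::finite \<Rightarrow> complex"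
  assumes f: "isCont f 0" and lam: "\<And>j. norm (lam j) < 1"
  shows "\<exists>K. \<forall>\<alpha>. norm (f (mpow lam \<alpha>)) \<le> K"
proof -
  obtain e where e: "0 < e" "\<And>\<mu>. norm \<mu> < e \<Longrightarrow> norm (f \<mu> - f 0) < 1"
    using f[unfolded continuous_at_eps_delta, rule_format, of 1] by (auto simp: dist_norm)
  define \<theta> where "\<theta> = Max (range (\<lambda>j. norm (lam j)))"
  have \<theta>: "norm (lam j) \<le> \<theta>" for j unfolding \<theta>_def by (rule Max_ge) auto
  have "\<theta> \<in> range (\<lambda>j. norm (lam j))" unfolding \<theta>_def by (rule Max_in) auto
  then have \<theta>01: "0 \<le> \<theta>" "\<theta> < 1" using lam by auto
  obtain n where n: "\<theta> ^ n < e"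
    using real_arch_pow_inv[OF e(1) \<theta>01(2)] by auto
  define K where "K = norm (f 0) + 1 + (\<Sum>\<alpha>\<in>{\<alpha>. mdeg \<alpha> < n}. norm (f (mpow lam \<alpha>)))"
  have "norm (f (mpow lam \<alpha>)) \<le> K" for \<alpha>
  proof (cases "mdeg \<alpha> < n")
    case True
    then have "norm (f (mpow lam \<alpha>)) \<le> (\<Sum>\<alpha>\<in>{\<alpha>. mdeg \<alpha> < n}. norm (f (mpow lam \<alpha>)))"
      by (intro member_le_sum finite_mdeg_less) auto
    then show ?thesis unfolding K_def by (simp add: add_increasing)
  next
    case False
    have "norm (mpow lam \<alpha>) \<le> \<theta> ^ mdeg \<alpha>"
      by (rule norm_mpow_le_power[OF \<theta>])
    also have "\<dots> \<le> \<theta> ^ n"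
      using False \<theta>01 by (intro power_decreasing) auto
    finally have "norm (f (mpow lam \<alpha>) - f 0) < 1"
      using n by (intro e(2)) auto
    then have "norm (f (mpow lam \<alpha>)) \<le> norm (f 0) + 1"
      using norm_triangle_sub[of "f (mpow lam \<alpha>)" "f 0"] by simp
    then show ?thesis unfolding K_def
      by (rule order_trans) (simp add: sum_nonneg)
  qed
  then show ?thesis by blast
qed

lemma isCont_det:
  fixes A :: "complex \<Rightarrow> complex^'n^'n"
  assumes "\<And>i j. isCont (\<lambda>\<mu>. A \<mu> $ i $ j) x"
  shows "isCont (\<lambda>\<mu>. det (A \<mu>)) x"
  unfolding det_def by (intro continuous_intros assms)

lemma matrix_mul_matrix_inv:
  fixes A :: "'a::semiring_1^'n^'m"
  assumes "invertible A"
  shows "A ** matrix_inv A = mat 1" and "matrix_inv A ** A = mat 1"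
  using someI_ex[OF assms[unfolded invertible_def]] by (auto simp: matrix_inv_def)

text \<open>Cramer's rule applied to the columns of the identity. It exhibits each entry of the
  inverse as a quotient of determinants, whose continuity is immediate.\<close>

lemma matrix_inv_entry:
  fixes A :: "complex^'n^'n"
  assumes "det A \<noteq> 0"
  shows "matrix_inv A $ r $ c = det (\<chi> i j. if j = r then axis c 1 $ i else A $ i $ j) / det A"
proof -
  have "A *v (matrix_inv A *v axis c 1) = axis c 1"
    using assms by (simp add: matrix_vector_mul_assoc matrix_mul_matrix_inv invertible_det_nz)
  then have "matrix_inv A *v axis c 1 = (\<chi> k. det (\<chi> i j. if j = k then axis c 1 $ i else A $ i $ j) / det A)"
    using cramer[OF assms] by blast
  moreover have "matrix_inv A $ r $ c = (matrix_inv A *v axis c 1) $ r"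
    by (simp add: matrix_vector_mult_def axis_def if_distrib cong: if_cong)
  ultimately show ?thesis by simp
qed

lemma matrix_inv_bounded_along_powers:
  fixes A :: "complex \<Rightarrow> complex^'d^'d" and lam :: "'m::finite \<Rightarrow> complex"
  assumes A: "\<And>i j. isCont (\<lambda>\<mu>. A \<mu> $ i $ j) 0" and A0: "det (A 0) \<noteq> 0"
    and lam: "\<And>j. norm (lam j) < 1"
  shows "\<exists>K. \<forall>\<alpha> r c. det (A (mpow lam \<alpha>)) \<noteq> 0 \<longrightarrow> norm (matrix_inv (A (mpow lam \<alpha>)) $ r $ c) \<le> K"
proof -
  \<comment> \<open>With x / 0 = 0 this quotient is total, so it can be bounded along all powers; a
    nonzero determinant enters only when it is identified with the inverse.\<close>
  let ?f = "\<lambda>r c \<mu>. det (\<chi> i j. if j = r then axis c 1 $ i else A \<mu> $ i $ j) / det (A \<mu>)"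
  have cont: "isCont (?f r c) 0" for r c
  proof -
    have "isCont (\<lambda>\<mu>. (\<chi> i j. if j = r then axis c 1 $ i else A \<mu> $ i $ j) $ i $ j) 0" for i j
      using A[of i j] by (cases "j = r") auto
    then show ?thesis
      using A A0 by (intro continuous_divide isCont_det) auto
  qed
  have "\<exists>K. \<forall>\<alpha>. norm (?f (fst rc) (snd rc) (mpow lam \<alpha>)) \<le> K" for rc
    by (rule bounded_along_powers[where lam = lam, OF cont lam])
  then have "\<exists>K. \<forall>rc. \<forall>\<alpha>. norm (?f (fst rc) (snd rc) (mpow lam \<alpha>)) \<le> K rc"
    by (intro choice) (rule allI)
  then obtain K where K: "\<forall>rc. \<forall>\<alpha>. norm (?f (fst rc) (snd rc) (mpow lam \<alpha>)) \<le> K rc" ..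
  have "norm (?f r c (mpow lam \<alpha>)) \<le> Max (range K)" for r c \<alpha>
  proof (rule order_trans)
    show "norm (?f r c (mpow lam \<alpha>)) \<le> K (r, c)"
      using K[rule_format, of "(r, c)" \<alpha>] unfolding fst_conv snd_conv .
    show "K (r, c) \<le> Max (range K)"
      by (rule Max_ge) auto
  qed
  then show ?thesis
    by (intro exI[of _ "Max (range K)"]) (simp add: matrix_inv_entry)
qed

definition vcoeff :: "'m::finite wiener^'d \<Rightarrow> ('m \<Rightarrow> nat) \<Rightarrow> complex^'d" where
  "vcoeff p \<alpha> = (\<chi> j. wcoeff (p $ j) \<alpha>)"

lemma vcoeff_eqI: "(\<And>\<alpha>. vcoeff p \<alpha> = vcoeff q \<alpha>) \<Longrightarrow> p = q"
  by (auto simp: vcoeff_def vec_eq_iff intro!: wiener_eqI)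

lemma vcoeff_diff: "vcoeff (p - q) \<alpha> = vcoeff p \<alpha> - vcoeff q \<alpha>"
  by (simp add: vcoeff_def vec_eq_iff)

lemma vcoeff_0: "vcoeff 0 \<alpha> = 0"
  by (simp add: vcoeff_def vec_eq_iff)

lemma wcoeff_sum: "wcoeff (\<Sum>x\<in>A. f x) \<alpha> = (\<Sum>x\<in>A. wcoeff (f x) \<alpha>)"
  by (rule linear_sum[OF bounded_linear.linear[OF bounded_linear_wcoeff]])

text \<open>In the rescaled variable \<open>z / \<sigma>\<close> the unknown \<open>P\<close> is an element of the algebra. Splitting
  \<open>Z\<close> into its linear part and a part \<open>H\<close> of order at least two, and inverting the linear part
  coefficientwise on the degrees at least two, turns the equation into \<open>p = w - G (H p)\<close>, where
  \<open>w\<close> is the prescribed linear term.\<close>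

locale invariance_equation =
  fixes c :: "'d::finite \<Rightarrow> ('b::finite \<times> 'd \<Rightarrow> nat) \<Rightarrow> complex" and s :: real
    and e :: "'b \<Rightarrow> nat" and lam :: "complex^'m" and T :: "complex \<Rightarrow> complex^'d^'d"
    and K :: real and v :: "'m \<Rightarrow> complex^'d"
  assumes s: "0 < s"
    and c: "\<And>r. (\<lambda>\<alpha>. norm (c r \<alpha>) * s ^ mdeg \<alpha>) summable_on UNIV"
    and c0: "\<And>r. c r (\<lambda>_. 0) = 0"
    and lam: "\<And>j. norm (lam $ j) < 1"
    and T: "\<And>\<mu> r j. T \<mu> $ r $ j = (\<Sum>k\<in>UNIV. c r (unit_index (k, j)) * \<mu> ^ e k)"
    and nonresonant: "\<And>\<alpha>. 2 \<le> mdeg \<alpha> \<Longrightarrow> invertible (T (mpow (\<lambda>j. lam $ j) \<alpha>))"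
    and K: "\<And>\<alpha> r j. 2 \<le> mdeg \<alpha> \<Longrightarrow> norm (matrix_inv (T (mpow (\<lambda>j. lam $ j) \<alpha>)) $ r $ j) \<le> K"
    and eigenvector: "\<And>j. T (lam $ j) *v v j = 0"
begin

abbreviation lpow :: "('m \<Rightarrow> nat) \<Rightarrow> complex" where
  "lpow \<alpha> \<equiv> mpow (\<lambda>j. lam $ j) \<alpha>"

text \<open>The functions z -> P(\<Lambda>^n z) with n = \<open>e k\<close>, in coefficients: the
  dilation multiplies the coefficient of index \<alpha> by (\<lambda>^\<alpha>)^n.\<close>

definition blocks :: "'m wiener^'d \<Rightarrow> 'b \<times> 'd \<Rightarrow> 'm wiener" where
  "blocks p = (\<lambda>(k, j). multiplier (\<lambda>\<alpha>. lpow \<alpha> ^ e k) (p $ j))"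

definition Zhat :: "'m wiener^'d \<Rightarrow> 'm wiener^'d" where
  "Zhat p = (\<chi> r. wsubst (c r) (blocks p))"

definition H :: "'m wiener^'d \<Rightarrow> 'm wiener^'d" where
  "H p = (\<chi> r. tail_series (\<lambda>\<alpha>. wconst (c r \<alpha>)) (blocks p))"

text \<open>The value 0 in degrees at most 1 makes \<open>G\<close> annihilate these degrees, so
  that every fixed point automatically carries the prescribed constant and linear
  coefficients.\<close>

definition Tinv :: "('m \<Rightarrow> nat) \<Rightarrow> complex^'d^'d" where
  "Tinv \<alpha> = (if 2 \<le> mdeg \<alpha> then matrix_inv (T (lpow \<alpha>)) else 0)"

definition G :: "'m wiener^'d \<Rightarrow> 'm wiener^'d" where
  "G h = (\<chi> r. \<Sum>j\<in>UNIV. multiplier (\<lambda>\<alpha>. Tinv \<alpha> $ r $ j) (h $ j))"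

lemma norm_lpow_power: "norm (lpow \<alpha> ^ n) \<le> 1"
proof -
  have "norm (lpow \<alpha>) \<le> 1"
    using norm_mpow_le_power[of "\<lambda>j. lam $ j" 1 \<alpha>] lam less_imp_le by fastforce
  then show ?thesis by (simp add: norm_power power_le_one)
qed

lemma norm_blocks_diff: "norm (blocks p k - blocks q k) \<le> norm (p - q)"
proof (cases k)
  case (Pair k j)
  then have "blocks p (k, j) - blocks q (k, j) = multiplier (\<lambda>\<alpha>. lpow \<alpha> ^ e k) ((p - q) $ j)"
    by (simp add: blocks_def multiplier_diff[OF norm_lpow_power])
  also have "norm \<dots> \<le> norm ((p - q) $ j)"
    using norm_multiplier_le[OF norm_lpow_power] by fastforce
  also have "\<dots> \<le> norm (p - q)"
    by (rule Finite_Cartesian_Product.norm_nth_le)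
  finally show ?thesis using Pair by simp
qed

lemma wcoeff_blocks: "wcoeff (blocks p (k, j)) \<alpha> = lpow \<alpha> ^ e k * wcoeff (p $ j) \<alpha>"
  by (simp add: blocks_def wcoeff_multiplier[OF norm_lpow_power])

lemma blocks_0: "blocks 0 k = 0"
  by (cases k) (auto intro!: wiener_eqI simp: wcoeff_blocks)

lemma norm_blocks: "norm (blocks p k) \<le> norm p"
  using norm_blocks_diff[of p k 0] by (simp add: blocks_0)

lemma weval_blocks:
  "weval z (blocks p (k, j)) = weval (\<lambda>i. lam $ i ^ e k * z i) (p $ j)"
proof -
  have "wcoeff (blocks p (k, j)) \<alpha> * mpow z \<alpha> = wcoeff (p $ j) \<alpha> * mpow (\<lambda>i. lam $ i ^ e k * z i) \<alpha>" for \<alpha>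
    by (simp add: wcoeff_blocks mpow_mult mpow_power mult_ac)
  then show ?thesis by (simp add: weval_def)
qed

text \<open>\<open>blocks\<close> does not increase differences, so the tail estimate applies in
  each component. The radius \<open>t\<close> stays explicit so that shrinking the ball can make the
  constant as small as desired.\<close>

lemma H_lipschitz:
  obtains A where "0 \<le> A"
    "\<And>t p q. 2 * t \<le> s \<Longrightarrow> norm p \<le> t \<Longrightarrow> norm q \<le> t \<Longrightarrow> norm (H p - H q) \<le> A * t * norm (p - q)"
proof -
  define M where "M r = infsum (\<lambda>\<alpha>. norm (c r \<alpha>) * s ^ mdeg \<alpha>) UNIV" for r
  define A where "A = (\<Sum>r\<in>UNIV. M r * (2 / s\<^sup>2))"
  have M: "0 \<le> M r" for r unfolding M_def using s by (intro infsum_nonneg) simp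
  have "0 \<le> A" unfolding A_def using M by (intro sum_nonneg) simp
  moreover have "norm (H p - H q) \<le> A * t * norm (p - q)"
    if t: "2 * t \<le> s" and p: "norm p \<le> t" and q: "norm q \<le> t" for t p q
  proof -
    have "norm (H p - H q) \<le> (\<Sum>r\<in>UNIV. norm ((H p - H q) $ r))"
      by (rule norm_vec_le_sum)
    also have "\<dots> \<le> (\<Sum>r\<in>UNIV. M r * (2 * t / s\<^sup>2 * norm (p - q)))"
    proof (rule sum_mono)
      fix r
      have "norm (tail_series (\<lambda>\<alpha>. wconst (c r \<alpha>)) (blocks p) - tail_series (\<lambda>\<alpha>. wconst (c r \<alpha>)) (blocks q))
          \<le> (\<Sum>\<^sub>\<infinity>\<alpha>. norm (wconst (c r \<alpha>) :: 'm wiener) * s ^ mdeg \<alpha>) * (2 * t / s\<^sup>2 * norm (p - q))"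
        by (rule tail_series_lipschitz[OF _ s t])
           (use c order_trans[OF norm_blocks] p q in \<open>auto simp: norm_wmonom intro: norm_blocks_diff\<close>)
      then show "norm ((H p - H q) $ r) \<le> M r * (2 * t / s\<^sup>2 * norm (p - q))"
        by (simp add: H_def M_def norm_wmonom)
    qed
    also have "\<dots> = A * t * norm (p - q)"
      unfolding A_def sum_distrib_right by (simp add: mult_ac)
    finally show ?thesis .
  qed
  ultimately show thesis by (rule that)
qed

lemma norm_Tinv: "norm (Tinv \<alpha> $ r $ j) \<le> \<bar>K\<bar>"
  using K[of \<alpha> r j] by (auto simp: Tinv_def)

lemma vcoeff_G: "vcoeff (G h) \<alpha> = Tinv \<alpha> *v vcoeff h \<alpha>"
  by (simp add: vcoeff_def G_def vec_eq_iff wcoeff_sum wcoeff_multiplier[OF norm_Tinv] matrix_vector_mult_def)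

lemma G_diff: "G g - G h = G (g - h)"
  by (rule vcoeff_eqI) (simp add: vcoeff_diff vcoeff_G matrix_vector_mult_diff_distrib)

lemma norm_G: "norm (G h) \<le> (real CARD('d))\<^sup>2 * \<bar>K\<bar> * norm h"
proof -
  have "norm (G h $ r) \<le> real CARD('d) * (\<bar>K\<bar> * norm h)" for r
  proof -
    have "norm (G h $ r) \<le> (\<Sum>j\<in>UNIV. norm (multiplier (\<lambda>\<alpha>. Tinv \<alpha> $ r $ j) (h $ j)))"
      by (simp add: G_def norm_sum)
    also have "\<dots> \<le> (\<Sum>j\<in>(UNIV :: 'd set). \<bar>K\<bar> * norm h)"
      by (intro sum_mono order_trans[OF norm_multiplier_le[OF norm_Tinv]] mult_left_mono
          Finite_Cartesian_Product.norm_nth_le) auto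
    finally show ?thesis by simp
  qed
  then have "norm (G h) \<le> real CARD('d) * (real CARD('d) * (\<bar>K\<bar> * norm h))"
    by (rule norm_vec_le_card)
  then show ?thesis by (simp add: power2_eq_square mult_ac)
qed

lemma H_0: "H 0 = 0"
proof -
  have "mpow (blocks 0) \<alpha> = 0" if "2 \<le> mdeg \<alpha>" for \<alpha>
    using that by (simp add: blocks_0[abs_def] mpow_const power_0_left)
  then show ?thesis
    by (auto simp: H_def tail_series_def vec_eq_iff intro!: infsum_0)
qed

text \<open>The threshold is independent of \<open>w\<close> and hence serves all scales \<sigma> at
  once.\<close>

lemma unique_fixed_point:
  obtains \<delta>0 where "0 < \<delta>0"
    "\<And>\<delta> w. 0 < \<delta> \<Longrightarrow> \<delta> \<le> \<delta>0 \<Longrightarrow> norm w \<le> \<delta> / 2 \<Longrightarrow> \<exists>!p. norm p \<le> \<delta> \<and> p = w - G (H p)"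
proof -
  obtain A where A: "0 \<le> A"
    "\<And>t p q. 2 * t \<le> s \<Longrightarrow> norm p \<le> t \<Longrightarrow> norm q \<le> t \<Longrightarrow> norm (H p - H q) \<le> A * t * norm (p - q)"
    using H_lipschitz by blast
  define L where "L = (real CARD('d))\<^sup>2 * \<bar>K\<bar> * A"
  have L: "0 \<le> L" unfolding L_def using A(1) by simp
  \<comment> \<open>The first bound meets the condition 2 \<delta> \<le> s of the tail estimate, the
    second forces L \<delta> \<le> 1 / 2.\<close>
  define \<delta>0 where "\<delta>0 = min (s / 2) (1 / (2 * L + 1))"
  have "0 < \<delta>0" using s L by (simp add: \<delta>0_def)
  moreover have "\<exists>!p. norm p \<le> \<delta> \<and> p = w - G (H p)"
    if \<delta>: "0 < \<delta>" "\<delta> \<le> \<delta>0" and w: "norm w \<le> \<delta> / 2" for \<delta> w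
  proof -
    have "\<delta> * (2 * L + 1) \<le> 1"
      using \<delta>(2) L by (simp add: \<delta>0_def field_simps)
    then have L\<delta>: "L * \<delta> \<le> 1 / 2" using \<delta>(1) by (simp add: algebra_simps)
    have lip: "norm (G (H p) - G (H q)) \<le> 1 / 2 * norm (p - q)" if "norm p \<le> \<delta>" "norm q \<le> \<delta>" for p q
    proof -
      have "norm (G (H p) - G (H q)) \<le> (real CARD('d))\<^sup>2 * \<bar>K\<bar> * norm (H p - H q)"
        unfolding G_diff by (rule norm_G)
      also have "\<dots> \<le> (real CARD('d))\<^sup>2 * \<bar>K\<bar> * (A * \<delta> * norm (p - q))"
        using \<delta> that by (intro mult_left_mono A(2)) (auto simp: \<delta>0_def)
      also have "\<dots> = L * \<delta> * norm (p - q)"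
        by (simp add: L_def mult_ac)
      also have "\<dots> \<le> 1 / 2 * norm (p - q)"
        by (rule mult_right_mono[OF L\<delta>]) simp
      finally show ?thesis .
    qed
    let ?\<Phi> = "\<lambda>p. w - G (H p)"
    have "\<exists>!p. p \<in> cball 0 \<delta> \<and> ?\<Phi> p = p"
    proof (rule Banach_fix)
      show "complete (cball (0 :: 'm wiener^'d) \<delta>)"
        by (simp add: complete_eq_closed)
      show "cball (0 :: 'm wiener^'d) \<delta> \<noteq> {}" using \<delta> by simp
      show "?\<Phi> ` cball 0 \<delta> \<subseteq> cball 0 \<delta>"
      proof (rule image_subsetI)
        fix p :: "'m wiener^'d" assume "p \<in> cball 0 \<delta>"
        then have p: "norm p \<le> \<delta>" by simp
        \<comment> \<open>Comparison with 0, where \<open>H\<close> vanishes, spends half of the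
          radius; the other half is reserved for \<open>w\<close>.\<close>
        have "norm (G (H p)) \<le> \<delta> / 2"
          using lip[OF p, of 0] p \<delta> norm_G[of "H 0"] by (simp add: H_0)
        then have "norm (?\<Phi> p) \<le> \<delta>"
          using norm_triangle_ineq4[of w "G (H p)"] w by simp
        then show "?\<Phi> p \<in> cball 0 \<delta>" by simp
      qed
      show "dist (?\<Phi> p) (?\<Phi> q) \<le> 1 / 2 * dist p q" if "p \<in> cball 0 \<delta>" "q \<in> cball 0 \<delta>" for p q
        using lip[of p q] that by (simp add: dist_norm norm_minus_commute)
    qed auto
    then show ?thesis by (metis dist_0_norm mem_cball)
  qed
  ultimately show thesis by (rule that)
qed

text \<open>The origin of the characteristic matrix: block \<open>k\<close> contributes its linear
  coefficients times (\<lambda>^\<alpha>)^(e k), and summation over the blocks gives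
  T(\<lambda>^\<alpha>).\<close>

lemma vcoeff_Zhat:
  assumes "norm p \<le> s"
  shows "vcoeff (Zhat p) \<alpha> = T (lpow \<alpha>) *v vcoeff p \<alpha> + vcoeff (H p) \<alpha>"
proof -
  have "wcoeff (Zhat p $ r) \<alpha> = (\<Sum>j\<in>UNIV. T (lpow \<alpha>) $ r $ j * wcoeff (p $ j) \<alpha>) + wcoeff (H p $ r) \<alpha>" for r
  proof -
    have "Zhat p $ r = wconst (c r (\<lambda>_. 0)) + (\<Sum>k\<in>UNIV. wconst (c r (unit_index k)) * blocks p k) + H p $ r"
      unfolding Zhat_def H_def
      by (simp add: wsubst_expand[OF c order_trans[OF norm_blocks assms]])
    moreover have "(wconst 0 :: 'm wiener) = 0"
      by (rule wiener_eqI) (simp add: wmonom.rep_eq)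
    ultimately have "wcoeff (Zhat p $ r) \<alpha>
        = (\<Sum>k\<in>UNIV. c r (unit_index k) * wcoeff (blocks p k) \<alpha>) + wcoeff (H p $ r) \<alpha>"
      by (simp add: c0 wcoeff_sum wcoeff_wconst_mult)
    also have "(\<Sum>k\<in>UNIV. c r (unit_index k) * wcoeff (blocks p k) \<alpha>)
        = (\<Sum>k\<in>UNIV. \<Sum>j\<in>UNIV. c r (unit_index (k, j)) * wcoeff (blocks p (k, j)) \<alpha>)"
      unfolding UNIV_Times_UNIV[symmetric] sum.cartesian_product by (rule sum.cong) auto
    also have "\<dots> = (\<Sum>j\<in>UNIV. T (lpow \<alpha>) $ r $ j * wcoeff (p $ j) \<alpha>)"
      by (subst sum.swap) (simp add: T wcoeff_blocks sum_distrib_left mult_ac)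
    finally show ?thesis .
  qed
  then show ?thesis
    by (simp add: vcoeff_def vec_eq_iff matrix_vector_mult_def)
qed

text \<open>The linear part of w -> P(\<sigma> w), whence the factor \<sigma>.\<close>

definition lin :: "real \<Rightarrow> 'm wiener^'d" where
  "lin \<sigma> = (\<chi> r. \<Sum>j\<in>UNIV. wmonom (unit_index j) (of_real \<sigma> * v j $ r))"

lemma vcoeff_lin_unit: "vcoeff (lin \<sigma>) (unit_index j) = of_real \<sigma> *s v j"
proof -
  have eq: "(unit_index i = unit_index j) = (j = i)" for i j :: 'm
    by (metis zero_neq_one)
  have "wcoeff (lin \<sigma> $ r) (unit_index j) = of_real \<sigma> * v j $ r" for r
    by (simp add: lin_def wcoeff_sum wmonom.rep_eq eq)
  then show ?thesis by (simp add: vcoeff_def vec_eq_iff)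
qed

lemma vcoeff_lin_other: "mdeg \<alpha> \<noteq> 1 \<Longrightarrow> vcoeff (lin \<sigma>) \<alpha> = 0"
  by (auto simp: lin_def vcoeff_def vec_eq_iff wcoeff_sum wmonom.rep_eq intro!: sum.neutral)

lemma norm_lin:
  obtains A where "0 < A" "\<And>\<sigma>. 0 \<le> \<sigma> \<Longrightarrow> norm (lin \<sigma>) \<le> A * \<sigma>"
proof -
  define A where "A = (\<Sum>r\<in>UNIV. \<Sum>j\<in>UNIV. norm (v j $ r)) + 1"
  have "norm (lin \<sigma>) \<le> A * \<sigma>" if \<sigma>: "0 \<le> \<sigma>" for \<sigma>
  proof -
    have "norm (lin \<sigma>) \<le> (\<Sum>r\<in>UNIV. norm (lin \<sigma> $ r))"
      by (rule norm_vec_le_sum)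
    also have "\<dots> \<le> (\<Sum>r\<in>UNIV. \<Sum>j\<in>UNIV. \<sigma> * norm (v j $ r))"
      by (intro sum_mono) (auto simp: lin_def norm_wmonom norm_mult \<sigma> intro!: sum_norm_le)
    also have "\<dots> \<le> A * \<sigma>"
      using \<sigma> by (simp add: A_def algebra_simps flip: sum_distrib_left)
    finally show ?thesis .
  qed
  moreover have "0 < A"
    unfolding A_def by (intro add_nonneg_pos sum_nonneg) auto
  ultimately show thesis using that by blast
qed

text \<open>In degree 0 the coefficient is zero; in degree 1 the power \<lambda>^\<alpha> is some
  \<lambda>_j and the eigenvector equation applies.\<close>

lemma T_vcoeff_lin: "mdeg \<alpha> \<le> 1 \<Longrightarrow> T (lpow \<alpha>) *v vcoeff (lin \<sigma>) \<alpha> = 0"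
proof (cases "mdeg \<alpha> = 1")
  case True
  then obtain j where "\<alpha> = unit_index j" unfolding mdeg_1_iff ..
  then show ?thesis
    by (simp only: vcoeff_lin_unit mpow_unit_index) (simp add: vector_scalar_commute eigenvector)
qed (simp add: vcoeff_lin_other)

lemma vcoeff_H_eq_0:
  assumes p: "norm p \<le> s" and "vcoeff p (\<lambda>_. 0) = 0" and \<alpha>: "mdeg \<alpha> \<le> 1"
  shows "vcoeff (H p) \<alpha> = 0"
proof -
  have "wcoeff (blocks p k) (\<lambda>_. 0) = 0" for k
    using assms(2) by (cases k) (simp add: wcoeff_blocks vcoeff_def vec_eq_iff)
  then show ?thesis
    unfolding vcoeff_def H_def vec_eq_iff
    by (simp add: wcoeff_tail_series_eq_0[OF c order_trans[OF norm_blocks p] _ \<alpha>])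
qed

lemma vcoeff_fixed_point:
  assumes "p = lin \<sigma> - G (H p)" and "mdeg \<alpha> \<le> 1"
  shows "vcoeff p \<alpha> = vcoeff (lin \<sigma>) \<alpha>"
proof -
  have "vcoeff p \<alpha> = vcoeff (lin \<sigma>) \<alpha> - vcoeff (G (H p)) \<alpha>"
    by (subst assms(1)) (rule vcoeff_diff)
  then show ?thesis using assms(2) by (simp add: vcoeff_G Tinv_def)
qed

text \<open>From degree two on, multiplying the fixed point equation by T(\<lambda>^\<alpha>)
  cancels the inverse. In lower degrees the linear and the nonlinear contribution vanish
  separately.\<close>

lemma Zhat_eq_0_of_fixed_point:
  assumes p: "norm p \<le> s" and fix_p: "p = lin \<sigma> - G (H p)"
  shows "Zhat p = 0"
proof (rule vcoeff_eqI)
  fix \<alpha>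
  show "vcoeff (Zhat p) \<alpha> = vcoeff 0 \<alpha>"
  proof (cases "2 \<le> mdeg \<alpha>")
    case True
    have "vcoeff p \<alpha> = vcoeff (lin \<sigma>) \<alpha> - vcoeff (G (H p)) \<alpha>"
      by (subst fix_p) (rule vcoeff_diff)
    then have "vcoeff p \<alpha> = - (matrix_inv (T (lpow \<alpha>)) *v vcoeff (H p) \<alpha>)"
      using True by (simp add: vcoeff_lin_other vcoeff_G Tinv_def)
    then have "T (lpow \<alpha>) *v vcoeff p \<alpha> = - ((T (lpow \<alpha>) ** matrix_inv (T (lpow \<alpha>))) *v vcoeff (H p) \<alpha>)"
      by (simp add: matrix_vector_mul_assoc linear_neg[OF matrix_vector_mul_linear])
    then show ?thesis
      using True by (simp add: vcoeff_Zhat[OF p] vcoeff_0 matrix_mul_matrix_inv nonresonant)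
  next
    case False
    then have \<alpha>: "mdeg \<alpha> \<le> 1" by simp
    have "vcoeff p (\<lambda>_. 0) = 0"
      by (simp add: vcoeff_fixed_point[OF fix_p] vcoeff_lin_other)
    then show ?thesis
      by (simp add: vcoeff_Zhat[OF p] vcoeff_0 vcoeff_H_eq_0[OF p _ \<alpha>] vcoeff_fixed_point[OF fix_p \<alpha>]
          T_vcoeff_lin[OF \<alpha>])
  qed
qed

text \<open>The converse, needed for uniqueness. The low coefficients enter as an assumption because
  T(\<lambda>^\<alpha>) is inverted only from degree two on.\<close>

lemma fixed_point_of_Zhat_eq_0:
  assumes p: "norm p \<le> s" and Z: "Zhat p = 0"
    and low: "\<And>\<alpha>. mdeg \<alpha> \<le> 1 \<Longrightarrow> vcoeff p \<alpha> = vcoeff (lin \<sigma>) \<alpha>"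
  shows "p = lin \<sigma> - G (H p)"
proof (rule vcoeff_eqI)
  fix \<alpha>
  show "vcoeff p \<alpha> = vcoeff (lin \<sigma> - G (H p)) \<alpha>"
  proof (cases "2 \<le> mdeg \<alpha>")
    case True
    have "T (lpow \<alpha>) *v vcoeff p \<alpha> + vcoeff (H p) \<alpha> = 0"
      using vcoeff_Zhat[OF p, of \<alpha>] Z by (simp add: vcoeff_0)
    then have "vcoeff (H p) \<alpha> = - (T (lpow \<alpha>) *v vcoeff p \<alpha>)"
      by (simp add: eq_neg_iff_add_eq_0 add.commute)
    then have "Tinv \<alpha> *v vcoeff (H p) \<alpha> = - ((matrix_inv (T (lpow \<alpha>)) ** T (lpow \<alpha>)) *v vcoeff p \<alpha>)"
      using True by (simp add: Tinv_def matrix_vector_mul_assoc linear_neg[OF matrix_vector_mul_linear])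
    then show ?thesis
      using True by (simp add: vcoeff_diff vcoeff_G vcoeff_lin_other matrix_mul_matrix_inv nonresonant)
  qed (simp add: vcoeff_diff vcoeff_G Tinv_def low)
qed

end

text \<open>Unconditional summability in the complex numbers is absolute, and at the diagonal point
  (s, ..., s) the monomials are exactly the weights.\<close>

lemma const_series_abs_summable:
  fixes f :: "('k::finite \<Rightarrow> nat) \<Rightarrow> complex"
  assumes "((\<lambda>\<alpha>. f \<alpha> * mpow (\<lambda>_. of_real s) \<alpha>) has_sum S) UNIV" and "0 \<le> s"
  shows "(\<lambda>\<alpha>. norm (f \<alpha>) * s ^ mdeg \<alpha>) summable_on UNIV"
  using has_sum_imp_summable[OF assms(1)] assms(2)
  by (simp add: summable_on_iff_abs_summable_on_complex norm_mult norm_power mpow_const)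

lemma has_derivative_vecI:
  fixes f :: "'a::real_normed_vector \<Rightarrow> 'b::real_normed_vector^'n"
  assumes f': "bounded_linear f'"
    and comp: "\<And>r. ((\<lambda>x. f x $ r) has_derivative (\<lambda>x. f' x $ r)) (at a)"
  shows "(f has_derivative f') (at a)"
  unfolding has_derivative_within
proof (intro conjI f' vec_tendstoI)
  fix r
  show "((\<lambda>y. ((1 / norm (y - a)) *\<^sub>R (f y - (f a + f' (y - a)))) $ r) \<longlongrightarrow> 0 $ r) (at a)"
    using comp[of r, unfolded has_derivative_within]
    by (simp only: vector_scaleR_component vector_minus_component vector_add_component zero_index)
qed

section \<open>Solutions near 0 and fixed points at scale \<sigma>\<close>

context invariance_equation
begin

definition rescaled :: "real \<Rightarrow> 'm wiener^'d \<Rightarrow> complex^'m \<Rightarrow> complex^'d" where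
  "rescaled \<sigma> p z = (\<chi> r. weval (\<lambda>i. z $ i / of_real \<sigma>) (p $ r))"

lemma scaled_in_unit_polydisc:
  fixes z :: "complex^'m"
  assumes "0 < \<sigma>" "norm z \<le> \<sigma>"
  shows "(\<lambda>i. z $ i / of_real \<sigma>) \<in> unit_polydisc"
  using assms order_trans[OF Finite_Cartesian_Product.norm_nth_le[of z] assms(2)] by (simp add: norm_divide)

lemma weval_Zhat:
  assumes p: "norm p \<le> s" and z: "(\<lambda>i. z $ i / of_real \<sigma>) \<in> unit_polydisc"
  shows "((\<lambda>\<alpha>. c r \<alpha> * mpow (\<lambda>(k, j). rescaled \<sigma> p (diagpow lam (e k) z) $ j) \<alpha>) has_sum
    weval (\<lambda>i. z $ i / of_real \<sigma>) (Zhat p $ r)) UNIV"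
proof -
  have "weval (\<lambda>i. z $ i / of_real \<sigma>) (blocks p k) = (case k of (k, j) \<Rightarrow> rescaled \<sigma> p (diagpow lam (e k) z) $ j)" for k
    by (cases k) (simp add: weval_blocks rescaled_def diagpow_def)
  then show ?thesis
    using weval_wsubst[OF c order_trans[OF norm_blocks p] z, of r] by (simp add: Zhat_def)
qed

lemma norm_rescaled:
  assumes "0 < \<sigma>" "norm z \<le> \<sigma>"
  shows "norm (rescaled \<sigma> p z) \<le> real CARD('d) * norm p"
proof (rule norm_vec_le_card)
  fix r
  show "norm (rescaled \<sigma> p z $ r) \<le> norm p"
    unfolding rescaled_def
    using order_trans[OF norm_weval_le[OF scaled_in_unit_polydisc[OF assms]] Finite_Cartesian_Product.norm_nth_le]
    by simp
qed

lemma rescaled_fixed_point_props: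
  assumes \<sigma>: "0 < \<sigma>" and p: "norm p \<le> s" and fix_p: "p = lin \<sigma> - G (H p)"
  shows "rescaled \<sigma> p 0 = 0"
    and "(rescaled \<sigma> p has_derivative (\<lambda>z. (\<chi> r j. v j $ r) *v z)) (at 0)"
    and "norm z \<le> \<sigma> \<Longrightarrow>
      ((\<lambda>\<alpha>. c r \<alpha> * mpow (\<lambda>(k, j). rescaled \<sigma> p (diagpow lam (e k) z) $ j) \<alpha>) has_sum 0) UNIV"
proof -
  have "vcoeff p (\<lambda>_. 0) = 0"
    by (simp add: vcoeff_fixed_point[OF fix_p] vcoeff_lin_other)
  then show "rescaled \<sigma> p 0 = 0"
    by (simp add: rescaled_def vcoeff_def vec_eq_iff weval_0)
  have unit: "wcoeff (p $ r) (unit_index j) = of_real \<sigma> * v j $ r" for r j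
    using vcoeff_fixed_point[OF fix_p, of "unit_index j"]
    by (simp only: vcoeff_lin_unit) (simp add: vcoeff_def vec_eq_iff)
  \<comment> \<open>Returning to the variable z divides each coefficient by \<sigma>^deg, which in
    degree one cancels the \<sigma> of \<open>lin \<sigma>\<close>.\<close>
  have "((\<lambda>z. rescaled \<sigma> p z $ r) has_derivative
      (\<lambda>z. \<Sum>j\<in>UNIV. wcoeff (p $ r) (unit_index j) / of_real \<sigma> ^ mdeg (unit_index j) * z $ j)) (at 0)" for r
  proof (rule mpow_series_has_derivative[OF _ \<sigma> \<sigma>, where c = "\<lambda>\<alpha>. wcoeff (p $ r) \<alpha> / of_real \<sigma> ^ mdeg \<alpha>"])
    show "(\<lambda>\<alpha>. norm (wcoeff (p $ r) \<alpha> / of_real \<sigma> ^ mdeg \<alpha>) * \<sigma> ^ mdeg \<alpha>) summable_on UNIV"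
      using \<sigma> wcoeff_abs_summable[of "p $ r" UNIV] by (simp add: norm_divide norm_power)
    fix z :: "complex^'m" assume z: "norm z < \<sigma>"
    have "mpow (\<lambda>k. z $ k) \<alpha> = of_real \<sigma> ^ mdeg \<alpha> * mpow (\<lambda>i. z $ i / of_real \<sigma>) \<alpha>" for \<alpha>
      unfolding mpow_const[symmetric] mpow_mult[symmetric] using \<sigma> by simp
    then show "((\<lambda>\<alpha>. wcoeff (p $ r) \<alpha> / of_real \<sigma> ^ mdeg \<alpha> * mpow (\<lambda>k. z $ k) \<alpha>) has_sum rescaled \<sigma> p z $ r) UNIV"
      using weval_has_sum[OF scaled_in_unit_polydisc[OF \<sigma>, of z], of "p $ r"] z \<sigma>
      by (simp add: rescaled_def)
  qed
  then have comp: "((\<lambda>z. rescaled \<sigma> p z $ r) has_derivative (\<lambda>z. ((\<chi> r j. v j $ r) *v z) $ r)) (at 0)" for r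
    using \<sigma> by (simp only: unit mdeg_unit_index) (simp add: matrix_vector_mult_def)
  show "(rescaled \<sigma> p has_derivative (\<lambda>z. (\<chi> r j. v j $ r) *v z)) (at 0)"
    by (rule has_derivative_vecI[OF matrix_vector_mul_bounded_linear comp])
  assume z: "norm z \<le> \<sigma>"
  show "((\<lambda>\<alpha>. c r \<alpha> * mpow (\<lambda>(k, j). rescaled \<sigma> p (diagpow lam (e k) z) $ j) \<alpha>) has_sum 0) UNIV"
    using weval_Zhat[OF p scaled_in_unit_polydisc[OF \<sigma> z], of r]
    by (simp add: Zhat_eq_0_of_fixed_point[OF p fix_p] weval_def)
qed

text \<open>Any solution, seen at a small enough scale, lies in the ball where fixed points are
  unique. The claim covers all \<sigma> below a threshold so that two solutions can be given the
  same scale.\<close>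

lemma fixed_point_of_solution:
  fixes Q :: "complex^'m \<Rightarrow> complex^'d" and d :: "('m \<Rightarrow> nat) \<Rightarrow> complex^'d"
  assumes \<delta>: "0 < \<delta>" "\<delta> \<le> s" and \<rho>: "0 < \<rho>"
    and Q: "\<And>z. norm z < \<rho> \<Longrightarrow> ((\<lambda>\<alpha>. mpow (\<lambda>i. z $ i) \<alpha> *s d \<alpha>) has_sum Q z) UNIV"
    and Q0: "Q 0 = 0" and Q': "(Q has_derivative (\<lambda>z. (\<chi> r j. v j $ r) *v z)) (at 0)"
    and sol: "\<And>z r. norm z < \<rho> \<Longrightarrow>
      ((\<lambda>\<alpha>. c r \<alpha> * mpow (\<lambda>(k, j). Q (diagpow lam (e k) z) $ j) \<alpha>) has_sum 0) UNIV"
  shows "\<exists>\<sigma>0>0. \<forall>\<sigma>. 0 < \<sigma> \<and> \<sigma> \<le> \<sigma>0 \<longrightarrow>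
    (\<exists>q. norm q \<le> \<delta> \<and> q = lin \<sigma> - G (H q) \<and> (\<forall>z. norm z \<le> \<sigma> \<longrightarrow> Q z = rescaled \<sigma> q z))"
proof -
  \<comment> \<open>Chosen so that the closed polydisc of radius \<open>t\<close> lies inside the
    ball of radius \<rho>.\<close>
  define t where "t = \<rho> / (2 * real CARD('m))"
  have t: "0 < t" using \<rho> by (simp add: t_def)
  have small: "norm z < \<rho>" if "\<And>i. norm (z $ i) \<le> t" for z :: "complex^'m"
    using norm_vec_le_card[of z t] that \<rho> by (simp add: t_def)
  have Qr: "((\<lambda>\<alpha>. d \<alpha> $ r * mpow (\<lambda>i. z $ i) \<alpha>) has_sum Q z $ r) UNIV" if "norm z < \<rho>" for z r
    using has_sum_vec_nth[OF Q[OF that], of r] by (simp add: mult.commute)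
  have d: "(\<lambda>\<alpha>. norm (d \<alpha> $ r) * t ^ mdeg \<alpha>) summable_on UNIV" for r
    using Qr[OF small[of "\<chi> i. of_real t"], of r] t by (intro const_series_abs_summable) auto
  have d0: "d (\<lambda>_. 0) = 0"
  proof -
    have "d (\<lambda>_. 0) $ r = Q 0 $ r" for r
    proof (rule has_sum_unique[OF _ Qr])
      show "((\<lambda>\<alpha>. d \<alpha> $ r * mpow (\<lambda>i. (0 :: complex^'m) $ i) \<alpha>) has_sum d (\<lambda>_. 0) $ r) UNIV"
        by (rule has_sum_finite_neutralI[of "{\<lambda>_. 0}"]) (auto simp: mpow_0)
    qed (simp add: \<rho>)
    then show ?thesis by (simp add: vec_eq_iff Q0)
  qed
  have d1: "d (unit_index j) = v j" for j
  proof -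
    have "d (unit_index j) $ r = v j $ r" for r
    proof -
      have 1: "((\<lambda>z. Q z $ r) has_derivative (\<lambda>z. \<Sum>i\<in>UNIV. d (unit_index i) $ r * z $ i)) (at 0)"
        by (rule mpow_series_has_derivative[OF d t \<rho> Qr])
      have 2: "((\<lambda>z. Q z $ r) has_derivative (\<lambda>z. ((\<chi> r j. v j $ r) *v z) $ r)) (at 0)"
        by (rule bounded_linear.has_derivative[OF bounded_linear_vec_nth Q'])
      show ?thesis
        using fun_cong[OF has_derivative_unique[OF 1 2], of "axis j 1"]
        by (simp add: matrix_vector_mult_def axis_def if_distrib cong: if_cong)
    qed
    then show ?thesis by (simp add: vec_eq_iff)
  qed
  define A where "A = (\<Sum>r\<in>UNIV. \<Sum>\<^sub>\<infinity>\<alpha>. norm (d \<alpha> $ r) * t ^ mdeg \<alpha>) + 1"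
  have "0 \<le> (\<Sum>r\<in>UNIV. \<Sum>\<^sub>\<infinity>\<alpha>. norm (d \<alpha> $ r) * t ^ mdeg \<alpha>)"
    using t by (intro sum_nonneg infsum_nonneg) simp
  then have A: "0 < A" by (simp add: A_def)
  \<comment> \<open>The second entry ensures \<sigma> A / t \<le> \<delta>, where \<open>A\<close>
    bounds the weighted norms of the coefficients at radius \<open>t\<close>.\<close>
  define \<sigma>0 where "\<sigma>0 = min t (\<delta> * t / A)"
  have "\<exists>q. norm q \<le> \<delta> \<and> q = lin \<sigma> - G (H q) \<and> (\<forall>z. norm z \<le> \<sigma> \<longrightarrow> Q z = rescaled \<sigma> q z)"
    if \<sigma>: "0 < \<sigma>" "\<sigma> \<le> \<sigma>0" for \<sigma>
  proof -
    have \<sigma>t: "\<sigma> \<le> t" using \<sigma> by (simp add: \<sigma>0_def)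
    \<comment> \<open>Only positive degrees occur, as \<open>Q\<close> vanishes at 0, so passing
      from radius \<open>t\<close> to \<sigma> gains at least one factor \<sigma> / t.\<close>
    have bound: "norm (d \<alpha> $ r * of_real \<sigma> ^ mdeg \<alpha>) \<le> \<sigma> / t * (norm (d \<alpha> $ r) * t ^ mdeg \<alpha>)" for \<alpha> r
    proof (cases "mdeg \<alpha>")
      case 0
      then show ?thesis by (simp add: mdeg_0_iff d0)
    next
      case (Suc n)
      have "\<sigma> ^ n \<le> t ^ n" using \<sigma> \<sigma>t by (intro power_mono) auto
      then have "norm (d \<alpha> $ r) * (\<sigma> * \<sigma> ^ n) \<le> norm (d \<alpha> $ r) * (\<sigma> * t ^ n)"
        using \<sigma> by (intro mult_left_mono) auto
      then show ?thesis using Suc \<sigma> t by (simp add: norm_mult norm_power mult_ac)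
    qed
    have qsum: "(\<lambda>\<alpha>. d \<alpha> $ r * of_real \<sigma> ^ mdeg \<alpha>) abs_summable_on UNIV" for r
      by (rule Infinite_Sum.abs_summable_on_comparison_test'[OF summable_on_cmult_right[OF d, of "\<sigma> / t"] bound])
    define q where "q = (\<chi> r. Wiener (\<lambda>\<alpha>. d \<alpha> $ r * of_real \<sigma> ^ mdeg \<alpha>))"
    have wq: "wcoeff (q $ r) = (\<lambda>\<alpha>. d \<alpha> $ r * of_real \<sigma> ^ mdeg \<alpha>)" for r
      by (simp add: q_def wcoeff_Wiener[OF qsum])
    have "norm q \<le> (\<Sum>r\<in>UNIV. norm (q $ r))"
      by (rule norm_vec_le_sum)
    also have "\<dots> \<le> (\<Sum>r\<in>UNIV. \<sigma> / t * (\<Sum>\<^sub>\<infinity>\<alpha>. norm (d \<alpha> $ r) * t ^ mdeg \<alpha>))"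
      unfolding norm_wiener_def infsum_cmult_right'[symmetric] wq
      by (intro sum_mono infsum_mono qsum summable_on_cmult_right d bound)
    also have "\<dots> \<le> \<sigma> / t * A"
      unfolding sum_distrib_left[symmetric] A_def using \<sigma> t by (intro mult_left_mono) auto
    also have "\<dots> \<le> \<delta>"
      using \<sigma> t A by (simp add: \<sigma>0_def field_simps)
    finally have nq: "norm q \<le> \<delta>" .
    \<comment> \<open>Stated on the polydisc instead of the ball, because separation of points below
      tests every \<open>w\<close> in the polydisc and also its images under the powers of
      \<Lambda>.\<close>
    have Qq: "Q z = rescaled \<sigma> q z" if z: "(\<lambda>i. z $ i / of_real \<sigma>) \<in> unit_polydisc" for z
    proof -
      have "norm (z $ i) \<le> t" for i
        using z \<sigma> \<sigma>t by (auto simp: norm_divide intro: order_trans[of _ \<sigma>])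
      then have z\<rho>: "norm z < \<rho>" by (rule small)
      have "mpow (\<lambda>k. z $ k) \<alpha> = of_real \<sigma> ^ mdeg \<alpha> * mpow (\<lambda>i. z $ i / of_real \<sigma>) \<alpha>" for \<alpha>
        unfolding mpow_const[symmetric] mpow_mult[symmetric] using \<sigma> by simp
      then have "((\<lambda>\<alpha>. d \<alpha> $ r * mpow (\<lambda>i. z $ i) \<alpha>) has_sum rescaled \<sigma> q z $ r) UNIV" for r
        using weval_has_sum[OF z, of "q $ r"] by (simp add: rescaled_def wq mult.assoc)
      then show ?thesis
        using has_sum_unique[OF Qr[OF z\<rho>]] by (auto simp: vec_eq_iff)
    qed
    have ns: "norm q \<le> s" using nq \<delta> by simp
    have "Zhat q $ r = 0" for r
    proof (rule weval_inject)
      fix w :: "'m \<Rightarrow> complex" assume w: "w \<in> unit_polydisc"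
      define z :: "complex^'m" where "z = (\<chi> i. of_real \<sigma> * w i)"
      have zw: "(\<lambda>i. z $ i / of_real \<sigma>) = w" using \<sigma> by (simp add: z_def)
      have "norm (w i) * \<sigma> \<le> 1 * t" for i
        using w \<sigma> \<sigma>t by (intro mult_mono) auto
      then have z\<rho>: "norm z < \<rho>"
        using \<sigma> by (intro small) (simp add: z_def norm_mult mult.commute)
      have "Q (diagpow lam n z) = rescaled \<sigma> q (diagpow lam n z)" for n
      proof (rule Qq)
        have "norm (lam $ i ^ n * w i) \<le> 1 * 1" for i
          unfolding norm_mult using w lam[of i] by (intro mult_mono) (auto simp: norm_power power_le_one)
        then show "(\<lambda>i. diagpow lam n z $ i / of_real \<sigma>) \<in> unit_polydisc"
          using \<sigma> by (simp add: diagpow_def z_def)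
      qed
      then have "((\<lambda>\<alpha>. c r \<alpha> * mpow (\<lambda>(k, j). Q (diagpow lam (e k) z) $ j) \<alpha>) has_sum weval w (Zhat q $ r)) UNIV"
        using weval_Zhat[OF ns, of z \<sigma> r] w by (simp add: zw)
      from has_sum_unique[OF this sol[OF z\<rho>]]
      show "weval w (Zhat q $ r) = weval w 0" by (simp add: weval_def)
    qed
    then have Z: "Zhat q = 0" by (simp add: vec_eq_iff)
    have "vcoeff q \<alpha> = vcoeff (lin \<sigma>) \<alpha>" if "mdeg \<alpha> \<le> 1" for \<alpha>
    proof (cases "mdeg \<alpha> = 1")
      case True
      then obtain j where j: "\<alpha> = unit_index j" unfolding mdeg_1_iff ..
      show ?thesis
        unfolding j by (simp only: vcoeff_lin_unit)
          (simp only: vcoeff_def wq d1 mdeg_unit_index, simp add: vec_eq_iff)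
    next
      case False
      then have "\<alpha> = (\<lambda>_. 0)" using that unfolding mdeg_0_iff[symmetric] by simp
      then show ?thesis by (simp add: vcoeff_lin_other) (simp add: vcoeff_def wq d0 vec_eq_iff)
    qed
    then have "q = lin \<sigma> - G (H q)"
      by (rule fixed_point_of_Zhat_eq_0[OF ns Z])
    moreover have "\<forall>z. norm z \<le> \<sigma> \<longrightarrow> Q z = rescaled \<sigma> q z"
      using Qq scaled_in_unit_polydisc[OF \<sigma>(1)] by blast
    ultimately show ?thesis using nq by blast
  qed
  moreover have "0 < \<sigma>0" using t \<delta> A by (simp add: \<sigma>0_def)
  ultimately show ?thesis by blast
qed

end

subsection \<open>The invariance equation\<close>

lemma norm_block_le:
  fixes x :: "complex^'d^'b"
  assumes "\<And>k j. norm (x $ k $ j) \<le> t"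
  shows "norm x \<le> real CARD('b) * (real CARD('d) * t)"
  by (intro norm_vec_le_card assms)

lemma mpow_blocks:
  "mpow (\<lambda>(k, j). f k j) (\<lambda>(k, j). \<alpha> k j) = (\<Prod>k\<in>UNIV. \<Prod>j\<in>UNIV. f k j ^ \<alpha> k j)"
proof -
  have "mpow (\<lambda>(k, j). f k j) (\<lambda>(k, j). \<alpha> k j) = (\<Prod>(k, j)\<in>UNIV. f k j ^ \<alpha> k j)"
    unfolding mpow_def by (rule prod.cong) auto
  then show ?thesis
    by (simp add: prod.cartesian_product)
qed

text \<open>Uncurrying the double index turns block variables into a single family indexed by pairs,
  to which the results on \<open>mpow\<close> apply.\<close>

lemma blk_analytic_on_series:
  fixes Z :: "complex^'d^'b \<Rightarrow> complex^'k"
  assumes "blk_analytic_on Z U" and "0 \<in> U"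
  obtains \<rho> c where "0 < \<rho>"
    "\<And>x r. norm x < \<rho> \<Longrightarrow> ((\<lambda>\<alpha>. c r \<alpha> * mpow (\<lambda>(k, j). x $ k $ j) \<alpha>) has_sum Z x $ r) UNIV"
proof -
  obtain \<rho> and c :: "('b \<Rightarrow> 'd \<Rightarrow> nat) \<Rightarrow> complex^'k" where \<rho>: "0 < \<rho>"
    and c: "\<And>x. x \<in> ball 0 \<rho> \<Longrightarrow>
      ((\<lambda>\<alpha>. (\<Prod>k\<in>UNIV. \<Prod>j\<in>UNIV. (x $ k $ j - 0 $ k $ j) ^ \<alpha> k j) *s c \<alpha>) has_sum Z x) UNIV"
    using assms unfolding blk_analytic_on_def by blast
  define c' where "c' r \<alpha> = c (\<lambda>k j. \<alpha> (k, j)) $ r" for r and \<alpha> :: "'b \<times> 'd \<Rightarrow> nat"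
  have "((\<lambda>\<alpha>. c' r \<alpha> * mpow (\<lambda>(k, j). x $ k $ j) \<alpha>) has_sum Z x $ r) UNIV" if x: "norm x < \<rho>" for x r
  proof -
    have "((\<lambda>\<alpha>. (\<Prod>k\<in>UNIV. \<Prod>j\<in>UNIV. x $ k $ j ^ \<alpha> k j) * c \<alpha> $ r) has_sum Z x $ r) UNIV"
      using has_sum_vec_nth[OF c, of x r] x by simp
    also have "?this \<longleftrightarrow> ?thesis"
    proof (rule has_sum_reindex_bij_witness[where j = "\<lambda>\<alpha> (k, j). \<alpha> k j" and i = "\<lambda>\<alpha> k j. \<alpha> (k, j)"])
      fix \<alpha> :: "'b \<Rightarrow> 'd \<Rightarrow> nat"
      show "c' r (\<lambda>(k, j). \<alpha> k j) * mpow (\<lambda>(k, j). x $ k $ j) (\<lambda>(k, j). \<alpha> k j)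
          = (\<Prod>k\<in>UNIV. \<Prod>j\<in>UNIV. x $ k $ j ^ \<alpha> k j) * c \<alpha> $ r"
        unfolding mpow_blocks c'_def by (simp add: mult.commute)
    qed auto
    finally show ?thesis .
  qed
  with \<rho> show thesis by (rule that)
qed

lemma vec_analytic_on_series:
  assumes "vec_analytic_on Q W" and "0 \<in> W"
  obtains \<rho> d where "0 < \<rho>"
    "\<And>z. norm z < \<rho> \<Longrightarrow> ((\<lambda>\<alpha>. mpow (\<lambda>i. z $ i) \<alpha> *s d \<alpha>) has_sum Q z) UNIV"
proof -
  obtain \<rho> d where "0 < \<rho>" "\<And>z. z \<in> ball 0 \<rho> \<Longrightarrow>
      ((\<lambda>\<alpha>. (\<Prod>i\<in>UNIV. (z $ i - 0 $ i) ^ \<alpha> i) *s d \<alpha>) has_sum Q z) UNIV"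
    using assms unfolding vec_analytic_on_def by blast
  then show thesis
    by (intro that[of \<rho> d]) (simp_all add: mpow_def)
qed

text \<open>\<open>Z\<close> is flattened to a function of one long vector, whose derivative at 0 is
  known from its series. Composing with the embedding \<iota> of block \<open>i\<close> gives a
  second derivative of the same map, and derivatives are unique.\<close>

lemma linear_coefficient_eq_partial_derivative:
  fixes Z :: "complex^'d^'b \<Rightarrow> complex^'k"
  assumes \<rho>: "0 < \<rho>" and s: "0 < s"
    and Z: "\<And>x. norm x < \<rho> \<Longrightarrow> ((\<lambda>\<alpha>. c \<alpha> * mpow (\<lambda>(k, j). x $ k $ j) \<alpha>) has_sum Z x $ r) UNIV"
    and c: "(\<lambda>\<alpha>. norm (c \<alpha>) * s ^ mdeg \<alpha>) summable_on UNIV"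
    and B: "((\<lambda>w. Z (\<chi> k. if k = i then w else 0)) has_derivative (\<lambda>w. B *v w)) (at 0)"
  shows "c (unit_index (i, j)) = B $ r $ j"
proof -
  define F where "F x = Z (\<chi> k j. x $ (k, j)) $ r" for x :: "complex^('b \<times> 'd)"
  define \<rho>' where "\<rho>' = \<rho> / (real CARD('b) * real CARD('d))"
  have \<rho>': "0 < \<rho>'" using \<rho> by (simp add: \<rho>'_def)
  have F': "(F has_derivative (\<lambda>x. \<Sum>q\<in>UNIV. c (unit_index q) * x $ q)) (at 0)"
  proof (rule mpow_series_has_derivative[OF c s \<rho>'])
    fix x :: "complex^('b \<times> 'd)" assume "norm x < \<rho>'"
    then have "real CARD('b) * (real CARD('d) * norm x) < \<rho>"
      by (simp add: \<rho>'_def field_simps)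
    moreover have "norm ((\<chi> k j. x $ (k, j)) :: complex^'d^'b) \<le> real CARD('b) * (real CARD('d) * norm x)"
      by (rule norm_block_le) (simp add: Finite_Cartesian_Product.norm_nth_le)
    ultimately have "norm ((\<chi> k j. x $ (k, j)) :: complex^'d^'b) < \<rho>" by simp
    from Z[OF this] show "((\<lambda>\<alpha>. c \<alpha> * mpow (\<lambda>k. x $ k) \<alpha>) has_sum F x) UNIV"
      by (simp add: F_def case_prod_beta)
  qed
  define \<iota> :: "complex^'d \<Rightarrow> complex^('b \<times> 'd)" where "\<iota> w = (\<chi> q. if fst q = i then w $ snd q else 0)" for w
  have "linear \<iota>"
    by (rule linearI) (auto simp: \<iota>_def vec_eq_iff)
  then have "bounded_linear \<iota>"
    by (rule linear_conv_bounded_linear[THEN iffD1])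
  then have "(\<iota> has_derivative \<iota>) (at 0)"
    by (rule bounded_linear_imp_has_derivative)
  moreover have "\<iota> 0 = 0" by (simp add: \<iota>_def vec_eq_iff)
  ultimately have 1: "((\<lambda>w. F (\<iota> w)) has_derivative (\<lambda>w. \<Sum>q\<in>UNIV. c (unit_index q) * \<iota> w $ q)) (at 0)"
    using has_derivative_compose[of \<iota> \<iota> 0 UNIV F] F' by simp
  have "F (\<iota> w) = Z (\<chi> k. if k = i then w else 0) $ r" for w
    unfolding F_def \<iota>_def by (rule arg_cong[where f = "\<lambda>x. Z x $ r"]) (simp add: vec_eq_iff)
  then have 2: "((\<lambda>w. F (\<iota> w)) has_derivative (\<lambda>w. (B *v w) $ r)) (at 0)"
    using bounded_linear.has_derivative[OF bounded_linear_vec_nth B] by simp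
  have "(\<Sum>q\<in>UNIV. c (unit_index q) * \<iota> (axis j 1) $ q) = (\<Sum>q\<in>UNIV. if q = (i, j) then c (unit_index (i, j)) else 0)"
    by (rule sum.cong) (auto simp: \<iota>_def axis_def)
  moreover have "(B *v axis j 1) $ r = B $ r $ j"
    by (simp add: matrix_vector_mult_def axis_def if_distrib cong: if_cong)
  ultimately show ?thesis
    using fun_cong[OF has_derivative_unique[OF 1 2], of "axis j 1"] by simp
qed

theorem mainTheorem8:
  fixes Z :: "complex^'d^'b \<Rightarrow> complex^'d"
    and U :: "(complex^'d^'b) set"
    and N :: nat and ix :: "nat \<Rightarrow> 'b"
    and B :: "nat \<Rightarrow> complex^'d^'d"
    and lam :: "complex^'m" and v :: "'m \<Rightarrow> complex^'d"
    and V :: "complex^'m^'d"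
  assumes ix: "bij_betw ix {0..N} (UNIV :: 'b set)"
    and U: "open U" "0 \<in> U"
    and Zan: "blk_analytic_on Z U"
    and Z0: "Z 0 = 0"
    and B: "\<And>i. i \<le> N \<Longrightarrow>
             ((\<lambda>w. Z (\<chi> k. if k = ix i then w else 0)) has_derivative (\<lambda>w. B i *v w)) (at 0)"
    and B0: "invertible (B 0)"
    and lam: "stable_nonresonant B N lam"
    and ev: "\<And>j. charT B N (lam$j) *v v j = 0" "\<And>j. v j \<noteq> 0"
    and V: "V = (\<chi> r j. v j $ r)"
  shows "\<exists>P W. open W \<and> 0 \<in> W \<and> vec_analytic_on P W \<and> P 0 = 0 \<and>
           (P has_derivative (\<lambda>z. V *v z)) (at 0) \<and> solves_inv Z U ix N lam P \<and>
           (\<forall>Q W'. open W' \<and> 0 \<in> W' \<and> vec_analytic_on Q W' \<and> Q 0 = 0 \<and>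
               (Q has_derivative (\<lambda>z. V *v z)) (at 0) \<and> solves_inv Z U ix N lam Q
             \<longrightarrow> (\<forall>\<^sub>F z in nhds 0. P z = Q z))"
proof -
  obtain \<rho>0 c where \<rho>0: "0 < \<rho>0" and Zc0:
    "\<And>x r. norm x < \<rho>0 \<Longrightarrow> ((\<lambda>\<alpha>. c r \<alpha> * mpow (\<lambda>(k, j). x $ k $ j) \<alpha>) has_sum Z x $ r) UNIV"
    using blk_analytic_on_series[OF Zan U(2)] by blast
  obtain \<rho>1 where \<rho>1: "0 < \<rho>1" "ball 0 \<rho>1 \<subseteq> U"
    using U openE by blast
  define \<rho> where "\<rho> = min \<rho>0 \<rho>1"
  have \<rho>: "0 < \<rho>" using \<rho>0 \<rho>1 by (simp add: \<rho>_def)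
  have Zc: "((\<lambda>\<alpha>. c r \<alpha> * mpow (\<lambda>(k, j). x $ k $ j) \<alpha>) has_sum Z x $ r) UNIV" and inU: "x \<in> U"
    if "norm x < \<rho>" for x r
    using that Zc0 \<rho>1 by (auto simp: \<rho>_def)
  let ?n = "real CARD('b) * real CARD('d)"
  \<comment> \<open>The block vector with all entries \<open>s\<close> has norm at most \<rho> / 2,
    so the series of \<open>Z\<close> converges there.\<close>
  define s where "s = \<rho> / (2 * ?n)"
  have s: "0 < s" using \<rho> by (simp add: s_def)
  have c: "(\<lambda>\<alpha>. norm (c r \<alpha>) * s ^ mdeg \<alpha>) summable_on UNIV" for r
  proof (rule const_series_abs_summable)
    have "norm ((\<chi> k j. of_real s) :: complex^'d^'b) \<le> real CARD('b) * (real CARD('d) * s)"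
      using s by (intro norm_block_le) simp
    also have "\<dots> < \<rho>" using \<rho> by (simp add: s_def)
    finally show "((\<lambda>\<alpha>. c r \<alpha> * mpow (\<lambda>_. of_real s) \<alpha>) has_sum Z (\<chi> k j. of_real s) $ r) UNIV"
      using Zc[of "\<chi> k j. of_real s" r] by (simp add: case_prod_unfold)
  qed (use s in simp)
  have c0: "c r (\<lambda>_. 0) = 0" for r
  proof -
    have "((\<lambda>\<alpha>. c r \<alpha> * mpow (\<lambda>(k, j). (0 :: complex^'d^'b) $ k $ j) \<alpha>) has_sum c r (\<lambda>_. 0)) UNIV"
      by (rule has_sum_finite_neutralI[of "{\<lambda>_. 0}"]) (auto simp: case_prod_unfold mpow_0)
    from has_sum_unique[OF this Zc] show ?thesis using \<rho> by (simp add: Z0)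
  qed
  define e where "e = inv_into {0..N} ix"
  have e_ix: "e (ix i) = i" if "i \<le> N" for i
    using that ix by (simp add: e_def bij_betw_def)
  have T: "charT B N \<mu> $ r $ j = (\<Sum>k\<in>UNIV. c r (unit_index (k, j)) * \<mu> ^ e k)" for \<mu> r j
  proof -
    have "c r (unit_index (ix i, j)) = B i $ r $ j" if "i \<le> N" for i
      by (rule linear_coefficient_eq_partial_derivative[OF \<rho> s Zc c B[OF that]])
    then have "charT B N \<mu> $ r $ j = (\<Sum>i\<in>{0..N}. c r (unit_index (ix i, j)) * \<mu> ^ e (ix i))"
      by (auto simp: charT_def e_ix atLeast0AtMost mult.commute intro!: sum.cong)
    then show ?thesis
      by (simp add: sum.reindex_bij_betw[OF ix, where g = "\<lambda>k. c r (unit_index (k, j)) * \<mu> ^ e k"])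
  qed
  have lam1: "norm (lam $ j) < 1" for j
    using lam by (simp add: stable_nonresonant_def)
  have nonres: "det (charT B N (mpow (\<lambda>j. lam $ j) \<alpha>)) \<noteq> 0" if "2 \<le> mdeg \<alpha>" for \<alpha>
    using lam that by (simp add: stable_nonresonant_def charF_def mdeg_def mpow_def)
  \<comment> \<open>As 0^0 = 1, only the term of index 0 survives in T(0). Invertibility of
    \<open>B 0\<close> thus controls the inverses near the limit 0 of the powers
    \<lambda>^\<alpha>.\<close>
  have "0 ^ i * B i $ r $ j = (if i = 0 then B 0 $ r $ j else 0)" for i r j
    by (cases i) auto
  then have "charT B N 0 = B 0"
    by (simp add: charT_def vec_eq_iff)
  then have det0: "det (charT B N 0) \<noteq> 0"
    using B0 by (simp add: invertible_det_nz)
  have "isCont (\<lambda>\<mu>. charT B N \<mu> $ i $ j) 0" for i j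
    unfolding charT_def by simp
  from matrix_inv_bounded_along_powers[where A = "charT B N" and lam = "\<lambda>j. lam $ j", OF this det0 lam1]
  obtain K where K: "\<forall>\<alpha> r j. det (charT B N (mpow (\<lambda>j. lam $ j) \<alpha>)) \<noteq> 0 \<longrightarrow>
      norm (matrix_inv (charT B N (mpow (\<lambda>j. lam $ j) \<alpha>)) $ r $ j) \<le> K" ..
  interpret invariance_equation c s e lam "charT B N" K v
  proof
    fix \<alpha> :: "'m \<Rightarrow> nat" and r j assume \<alpha>: "2 \<le> mdeg \<alpha>"
    show "invertible (charT B N (mpow (\<lambda>j. lam $ j) \<alpha>))"
      using nonres[OF \<alpha>] by (simp add: invertible_det_nz)
    show "norm (matrix_inv (charT B N (mpow (\<lambda>j. lam $ j) \<alpha>)) $ r $ j) \<le> K"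
      by (rule K[rule_format, OF nonres[OF \<alpha>]])
  qed (fact s c c0 lam1 T ev(1))+
  have orbit: "(\<lambda>(k, j). orbit_blk ix N P lam z $ k $ j) = (\<lambda>(k, j). P (diagpow lam (e k) z) $ j)" for P z
    by (simp add: orbit_blk_def e_def)
  have norm_diagpow: "norm (diagpow lam n z) \<le> norm z" for n z
  proof (rule norm_le_componentwise_cart)
    fix i
    have "norm (lam $ i) ^ n * norm (z $ i) \<le> 1 * norm (z $ i)"
      using lam1[of i] by (intro mult_right_mono power_le_one) auto
    then show "norm (diagpow lam n z $ i) \<le> norm (z $ i)"
      by (simp add: diagpow_def norm_mult norm_power)
  qed
  obtain \<delta>0 where \<delta>0: "0 < \<delta>0"
    "\<And>\<delta> w. 0 < \<delta> \<Longrightarrow> \<delta> \<le> \<delta>0 \<Longrightarrow> norm w \<le> \<delta> / 2 \<Longrightarrow> \<exists>!p. norm p \<le> \<delta> \<and> p = w - G (H p)"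
    using unique_fixed_point by blast
  \<comment> \<open>The bounds serve, in order, the contraction, substitution into the series of
    \<open>Z\<close>, and orbits staying in the ball of radius \<rho>. The extra CARD('d) pays for
    passing from the norm in the algebra to the norm of values; the 2 makes the inequality
    strict.\<close>
  define \<delta> where "\<delta> = Min {\<delta>0, s, \<rho> / (2 * (?n * real CARD('d)))}"
  have \<delta>: "0 < \<delta>" "\<delta> \<le> \<delta>0" "\<delta> \<le> s" and "\<delta> \<le> \<rho> / (2 * (?n * real CARD('d)))"
    using \<delta>0(1) s \<rho> by (auto simp: \<delta>_def)
  then have \<delta>\<rho>: "real CARD('b) * (real CARD('d) * (real CARD('d) * \<delta>)) < \<rho>"
    using \<rho> by (simp add: field_simps)
  obtain A where A: "0 < A" "\<And>\<sigma>. 0 \<le> \<sigma> \<Longrightarrow> norm (lin \<sigma>) \<le> A * \<sigma>"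
    using norm_lin by blast
  \<comment> \<open>Makes the norm of the linear term at most \<delta> / 2, as the fixed point lemma
    requires.\<close>
  define \<sigma>1 where "\<sigma>1 = \<delta> / (2 * A)"
  have \<sigma>1: "0 < \<sigma>1" using \<delta> A by (simp add: \<sigma>1_def)
  have unique: "\<exists>!p. norm p \<le> \<delta> \<and> p = lin \<sigma> - G (H p)" if "0 < \<sigma>" "\<sigma> \<le> \<sigma>1" for \<sigma>
  proof (rule \<delta>0(2)[OF \<delta>(1,2)])
    have "A * \<sigma> \<le> A * \<sigma>1" using that A by (intro mult_left_mono) auto
    then show "norm (lin \<sigma>) \<le> \<delta> / 2"
      using A(2)[of \<sigma>] A(1) that by (simp add: \<sigma>1_def)
  qed
  \<comment> \<open>The domain of analyticity is hidden in an existential so that the constructed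
    \<open>P\<close> and any competitor are handled by the same statement.\<close>
  define admissible where "admissible Q \<longleftrightarrow> (\<exists>W. open W \<and> 0 \<in> W \<and> vec_analytic_on Q W) \<and> Q 0 = 0 \<and>
    (Q has_derivative (\<lambda>z. V *v z)) (at 0) \<and> solves_inv Z U ix N lam Q" for Q
  have fixed_point: "\<exists>\<sigma>0>0. \<forall>\<sigma>. 0 < \<sigma> \<and> \<sigma> \<le> \<sigma>0 \<longrightarrow>
      (\<exists>q. norm q \<le> \<delta> \<and> q = lin \<sigma> - G (H q) \<and> (\<forall>z. norm z \<le> \<sigma> \<longrightarrow> Q z = rescaled \<sigma> q z))"
    if Q: "admissible Q" for Q
  proof -
    obtain \<rho>2 d where \<rho>2: "0 < \<rho>2"
      and d: "\<And>z. norm z < \<rho>2 \<Longrightarrow> ((\<lambda>\<alpha>. mpow (\<lambda>i. z $ i) \<alpha> *s d \<alpha>) has_sum Q z) UNIV"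
      using Q vec_analytic_on_series unfolding admissible_def by metis
    have Q0: "Q 0 = 0" and Q': "(Q has_derivative (\<lambda>z. (\<chi> r j. v j $ r) *v z)) (at 0)"
      using Q by (auto simp: admissible_def V)
    obtain W where W: "open W" "0 \<in> W" "\<And>z. z \<in> W \<Longrightarrow> Z (orbit_blk ix N Q lam z) = 0"
      using Q by (auto simp: admissible_def solves_inv_def)
    obtain \<rho>3 where \<rho>3: "0 < \<rho>3" "ball 0 \<rho>3 \<subseteq> W"
      using W openE by blast
    have "isCont Q 0" by (rule has_derivative_continuous[OF Q'])
    then obtain \<rho>4 where \<rho>4: "0 < \<rho>4" "\<And>z. norm z < \<rho>4 \<Longrightarrow> norm (Q z) < \<delta>"
      using \<delta>(1) Q0 by (auto simp: continuous_at_eps_delta dist_norm)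
    show ?thesis
    proof (rule fixed_point_of_solution[OF \<delta>(1,3) _ _ Q0 Q'])
      show "0 < Min {\<rho>2, \<rho>3, \<rho>4}" using \<rho>2 \<rho>3 \<rho>4 by simp
      fix z :: "complex^'m" assume z: "norm z < Min {\<rho>2, \<rho>3, \<rho>4}"
      then show "((\<lambda>\<alpha>. mpow (\<lambda>i. z $ i) \<alpha> *s d \<alpha>) has_sum Q z) UNIV"
        by (intro d) simp
      fix r
      have "norm (orbit_blk ix N Q lam z $ k $ j) \<le> \<delta>" for k j
      proof -
        have "norm (orbit_blk ix N Q lam z $ k) < \<delta>"
          unfolding orbit_blk_def using norm_diagpow z
          by (auto intro!: \<rho>4(2) intro: le_less_trans)
        then show ?thesis
          using Finite_Cartesian_Product.norm_nth_le[of "orbit_blk ix N Q lam z $ k" j] by simp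
      qed
      then have "norm (orbit_blk ix N Q lam z) \<le> real CARD('b) * (real CARD('d) * \<delta>)"
        by (rule norm_block_le)
      also have "\<dots> \<le> real CARD('b) * (real CARD('d) * (real CARD('d) * \<delta>))"
        using \<delta>(1) by (intro mult_left_mono) (auto simp: Suc_le_eq)
      finally have "norm (orbit_blk ix N Q lam z) < \<rho>" using \<delta>\<rho> by simp
      from Zc[OF this, of r]
      show "((\<lambda>\<alpha>. c r \<alpha> * mpow (\<lambda>(k, j). Q (diagpow lam (e k) z) $ j) \<alpha>) has_sum 0) UNIV"
        using W(3)[of z] \<rho>3 z by (auto simp: orbit)
    qed
  qed
  obtain p where p: "norm p \<le> \<delta>" "p = lin \<sigma>1 - G (H p)"
    using unique[OF \<sigma>1 order.refl] by blast
  define P where "P = rescaled \<sigma>1 p"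
  have ps: "norm p \<le> s" using p(1) \<delta> by simp
  have P_an: "vec_analytic_on P (ball 0 \<sigma>1)"
    unfolding P_def rescaled_def[abs_def] by (rule vec_analytic_on_weval[OF \<sigma>1])
  have "solves_inv Z U ix N lam P"
    unfolding solves_inv_def
  proof (intro exI[of _ "ball 0 \<sigma>1"] conjI ballI)
    fix z :: "complex^'m" assume "z \<in> ball 0 \<sigma>1"
    then have z: "norm z \<le> \<sigma>1" by simp
    have "norm (orbit_blk ix N P lam z $ k $ j) \<le> real CARD('d) * \<delta>" for k j
    proof -
      have "norm (orbit_blk ix N P lam z $ k) \<le> real CARD('d) * norm p"
        using norm_rescaled[OF \<sigma>1 order_trans[OF norm_diagpow z]] by (simp add: orbit_blk_def P_def)
      also have "\<dots> \<le> real CARD('d) * \<delta>" using p(1) by simp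
      finally show ?thesis
        using Finite_Cartesian_Product.norm_nth_le order_trans by blast
    qed
    then have small: "norm (orbit_blk ix N P lam z) < \<rho>"
      using norm_block_le \<delta>\<rho> by (meson le_less_trans)
    then show "orbit_blk ix N P lam z \<in> U" by (rule inU)
    have "Z (orbit_blk ix N P lam z) $ r = 0" for r
      using has_sum_unique[OF Zc[OF small, of r, unfolded orbit]]
        rescaled_fixed_point_props(3)[OF \<sigma>1 ps p(2) z, of r] by (simp add: P_def)
    then show "Z (orbit_blk ix N P lam z) = 0" by (simp add: vec_eq_iff)
  qed (use \<sigma>1 in auto)
  then have P: "admissible P"
    unfolding admissible_def V
    using P_an \<sigma>1 rescaled_fixed_point_props(1,2)[OF \<sigma>1 ps p(2)]
    by (auto simp: P_def intro!: exI[of _ "ball 0 \<sigma>1"])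
  have "\<forall>\<^sub>F z in nhds 0. P z = Q z" if Q: "admissible Q" for Q
  proof -
    \<comment> \<open>\<open>P\<close> is treated like any other solution: at a scale below
      \<sigma>1 the linear term changes, and its rescaling solves a different fixed point equation
      than \<open>p\<close>.\<close>
    obtain \<sigma>P where \<sigma>P: "0 < \<sigma>P" "\<And>\<sigma>. 0 < \<sigma> \<Longrightarrow> \<sigma> \<le> \<sigma>P \<Longrightarrow>
      \<exists>q. norm q \<le> \<delta> \<and> q = lin \<sigma> - G (H q) \<and> (\<forall>z. norm z \<le> \<sigma> \<longrightarrow> P z = rescaled \<sigma> q z)"
      using fixed_point[OF P] by blast
    obtain \<sigma>Q where \<sigma>Q: "0 < \<sigma>Q" "\<And>\<sigma>. 0 < \<sigma> \<Longrightarrow> \<sigma> \<le> \<sigma>Q \<Longrightarrow>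
      \<exists>q. norm q \<le> \<delta> \<and> q = lin \<sigma> - G (H q) \<and> (\<forall>z. norm z \<le> \<sigma> \<longrightarrow> Q z = rescaled \<sigma> q z)"
      using fixed_point[OF Q] by blast
    define \<sigma> where "\<sigma> = Min {\<sigma>1, \<sigma>P, \<sigma>Q}"
    have \<sigma>: "0 < \<sigma>" "\<sigma> \<le> \<sigma>1" "\<sigma> \<le> \<sigma>P" "\<sigma> \<le> \<sigma>Q"
      using \<sigma>1 \<sigma>P(1) \<sigma>Q(1) by (auto simp: \<sigma>_def)
    obtain q1 where q1: "norm q1 \<le> \<delta>" "q1 = lin \<sigma> - G (H q1)" "\<And>z. norm z \<le> \<sigma> \<Longrightarrow> P z = rescaled \<sigma> q1 z"
      using \<sigma>P(2)[OF \<sigma>(1,3)] by blast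
    obtain q2 where q2: "norm q2 \<le> \<delta>" "q2 = lin \<sigma> - G (H q2)" "\<And>z. norm z \<le> \<sigma> \<Longrightarrow> Q z = rescaled \<sigma> q2 z"
      using \<sigma>Q(2)[OF \<sigma>(1,4)] by blast
    have "q1 = q2"
      using unique[OF \<sigma>(1,2)] q1(1,2) q2(1,2) by blast
    then have "P z = Q z" if "z \<in> ball 0 \<sigma>" for z
      using q1(3)[of z] q2(3)[of z] that by simp
    then show ?thesis
      using \<sigma>(1) by (intro eventually_nhds_in_open[THEN eventually_mono, of "ball 0 \<sigma>"]) auto
  qed
  with P show ?thesis
    using P_an \<sigma>1 unfolding admissible_def
    by (intro exI[of _ P] exI[of _ "ball 0 \<sigma>1"]) auto
qed

end
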